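(* Let $s\ge 1$ and let $a_1,\dots,a_s\in\mathbb{C}$. Then in $\mathbb{C}[[x,y]]$ $$\exp\Big(\sum_{j=1}^{s}a_j\varphi_{-j}\varphi^*_0\Big)\cdot 1=\frac{1}{1-\sum_{j=1}^{s}a_jS_j(-x-y)}\exp\left(-\sum_{n\ge1}x_n\left(\frac{-\sum_{j=1}^{s}a_jS_{j-1}(-x-y)}{1-\sum_{j=1}^{s}a_jS_j(-x-y)}\right)^{n}\right).$$
   Context: Let $x=(x_1,x_2,\dots)$, $y=(y_1,y_2,\dots)$ and $p$ be formal variables and let $\mathcal{B}=\mathbb{C}[[x,y;p,p^{-1}]]$ be the (completed) bosonic Fock space. Write $\partial x_n=\partial/\partial x_n$, $\partial y_n=\partial/\partial y_n$, $\partial p=\partial/\partial p$. The operators $\varphi_i,\varphi^*_i$ ($i\in\mathbb{Z}$) on $\mathcal{B}$ are defined by the generating series $\varphi(z)=\sum_{i\in\mathbb{Z}}\varphi_iz^{-i-1}$ and $\varphi^*(z)=\sum_{i\in\mathbb{Z}}\varphi^*_iz^{-i}$, where $$\varphi^{*}(z)=p\exp\Big(\sum_{n>0}(x_n+y_n)z^n\Big)\Big(\sum_{k>0}kx_kz^{k-1}+\sum_{k>0}\partial x_k\,z^{-k-1}+p\,\partial p\,z^{-1}\Big)\exp\Big(-\sum_{n>0}(\partial x_n-\partial y_n)\tfrac{z^{-n}}{n}\Big),$$ $$\varphi(z)=p^{-1}\exp\Big(-\sum_{n>0}(x_n+y_n)z^n\Big)\exp\Big(\sum_{n>0}(\partial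 x_n-\partial y_n)\tfrac{z^{-n}}{n}\Big).$$ They satisfy $[\varphi_i,\varphi^*_j]=\delta_{i,-j}$, $[\varphi_i,\varphi_j]=[\varphi^*_i,\varphi^*_j]=0$, and $1\in\mathcal{B}$ is a vacuum vector: $\varphi_i\cdot1=\varphi^*_{i+1}\cdot1=0$ for $i\ge0$. For a sequence $t=(t_1,t_2,\dots)$ the elementary Schur polynomials $S_k(t)$ are defined by $\sum_{k\ge0}S_k(t)w^k=\exp(\sum_{n\ge1}t_nw^n)$ (and $S_k=0$ for $k<0$); $S_k(-x-y)$ is the value at $t_n=-x_n-y_n$. The operator exponential is the usual power series applied to $1$; it converges coefficientwise in $\mathbb{C}[[x,y]]$. Inverses of power series with constant term $1$ are taken in $\mathbb{C}[[x,y]]$. *)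

theory Defs
  imports "HOL-Analysis.Analysis" "HOL-Library.Multiset" "HOL-Library.Function_Algebras"
begin

section \<open>Formal power series in arbitrarily many variables\<close>

text \<open>
  A monomial in the variables \<open>'v\<close> is a finite multiset of variables, so that multiplication
  of monomials is addition of multisets and divisibility is \<open>\<subseteq>#\<close>.
\<close>

typedef ('v, 'a) mfps = "UNIV :: ('v multiset \<Rightarrow> 'a) set"
  morphisms mfps_coeff Abs_mfps ..

lemma mfps_coeff_Abs [simp]: "mfps_coeff (Abs_mfps c) = c"
  by (simp add: Abs_mfps_inverse)

lemma Abs_mfps_coeff [simp]: "Abs_mfps (mfps_coeff f) = f"
  by (simp add: mfps_coeff_inverse)

lemma mfps_eqI: "(\<And>m. mfps_coeff f m = mfps_coeff g m) \<Longrightarrow> f = g"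
  by (metis mfps_coeff_inverse ext)

lemma finite_divisors_mset: "finite {b. b \<subseteq># (m :: 'v multiset)}"
proof (induction m)
  case empty
  then show ?case by simp
next
  case (add x m)
  have "{b. b \<subseteq># add_mset x m} \<subseteq> {b. b \<subseteq># m} \<union> add_mset x ` {b. b \<subseteq># m}"
  proof
    fix b assume "b \<in> {b. b \<subseteq># add_mset x m}"
    then have b: "b \<subseteq># add_mset x m" by simp
    show "b \<in> {b. b \<subseteq># m} \<union> add_mset x ` {b. b \<subseteq># m}"
    proof (cases "x \<in># b")
      case True
      then obtain c where "b = add_mset x c" by (metis insert_DiffM)
      with b show ?thesis by auto
    next
      case False
      then show ?thesis using b
        by (metis UnI1 add_mset_remove_trivial diff_single_trivial mem_Collect_eq
            subset_eq_diff_conv add_mset_add_single)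
    qed
  qed
  with add show ?case by (meson finite_Un finite_imageI finite_subset)
qed

instantiation mfps :: (type, comm_ring_1) comm_ring_1
begin

definition "0 = Abs_mfps (\<lambda>_. 0)"
definition "1 = Abs_mfps (\<lambda>m. if m = {#} then 1 else 0)"
definition "f + g = Abs_mfps (\<lambda>m. mfps_coeff f m + mfps_coeff g m)"
definition "- f = Abs_mfps (\<lambda>m. - mfps_coeff f m)"
definition "f - g = Abs_mfps (\<lambda>m. mfps_coeff f m - mfps_coeff g m)"
definition "f * g = Abs_mfps (\<lambda>m. \<Sum>b | b \<subseteq># m. mfps_coeff f b * mfps_coeff g (m - b))"

instance
proof
  fix f g h :: "('a, 'b) mfps"
  show "f * g * h = f * (g * h)"
  proof (rule mfps_eqI)
    fix m :: "'a multiset"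
    let ?f = "mfps_coeff f" and ?g = "mfps_coeff g" and ?h = "mfps_coeff h"
    have "mfps_coeff (f * g * h) m
        = (\<Sum>b | b \<subseteq># m. \<Sum>c | c \<subseteq># b. ?f c * ?g (b - c) * ?h (m - b))"
      by (simp add: times_mfps_def sum_distrib_right)
    also have "\<dots> = (\<Sum>(b, c) \<in> Sigma {b. b \<subseteq># m} (\<lambda>b. {c. c \<subseteq># b}).
        ?f c * ?g (b - c) * ?h (m - b))"
      by (simp add: sum.Sigma finite_divisors_mset)
    also have "\<dots> = (\<Sum>(c, d) \<in> Sigma {c. c \<subseteq># m} (\<lambda>c. {d. d \<subseteq># m - c}).
        ?f c * (?g d * ?h (m - c - d)))"
    proof (rule sum.reindex_bij_witness
        [where i = "\<lambda>(c, d). (c + d, c)" and j = "\<lambda>(b, c). (c, b - c)"], goal_cases)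
      case (1 p)
      then show ?case by (auto simp: subset_mset.add_diff_inverse)
    next
      case (2 p)
      then obtain b c where p: "p = (b, c)" "b \<subseteq># m" "c \<subseteq># b" by auto
      then have "c \<subseteq># m" "b - c \<subseteq># m - c"
        by (auto simp: subseteq_mset_def intro: order_trans diff_le_mono)
      with p show ?case by simp
    next
      case (3 p)
      then show ?case by auto
    next
      case (4 p)
      then obtain c d where p: "p = (c, d)" "c \<subseteq># m" "d \<subseteq># m - c" by auto
      then have "c + d \<subseteq># m" by (simp add: subset_mset.le_diff_conv2 add.commute)
      with p show ?case by simp
    next
      case (5 p)
      then show ?case by (auto simp: mult.assoc)
    qed
    also have "\<dots> = (\<Sum>c | c \<subseteq># m. \<Sum>d | d \<subseteq># m - c. ?f c * (?g d * ?h (m - c - d)))"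
      by (simp add: sum.Sigma finite_divisors_mset)
    also have "\<dots> = mfps_coeff (f * (g * h)) m"
      by (simp add: times_mfps_def sum_distrib_left)
    finally show "mfps_coeff (f * g * h) m = mfps_coeff (f * (g * h)) m" .
  qed
  show "f * g = g * f"
  proof (rule mfps_eqI)
    fix m :: "'a multiset"
    have dd: "m - (m - b) = b" if "b \<subseteq># m" for b
      using that by (auto simp: subset_mset.le_iff_add)
    show "mfps_coeff (f * g) m = mfps_coeff (g * f) m"
      unfolding times_mfps_def mfps_coeff_Abs
      by (rule sum.reindex_bij_witness [where i = "\<lambda>b. m - b" and j = "\<lambda>b. m - b"])
         (auto simp: mult.commute dd)
  qed
  show "1 * f = f"
  proof (rule mfps_eqI)
    fix m :: "'a multiset"
    have "mfps_coeff (1 * f) m = (\<Sum>b | b \<subseteq># m. if b = {#} then mfps_coeff f m else 0)"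
      unfolding times_mfps_def one_mfps_def mfps_coeff_Abs by (rule sum.cong) auto
    then show "mfps_coeff (1 * f) m = mfps_coeff f m"
      by (simp add: sum.delta finite_divisors_mset)
  qed
  show "(f + g) * h = f * h + g * h"
    by (rule mfps_eqI) (simp add: times_mfps_def plus_mfps_def distrib_right sum.distrib)
  show "(0 :: ('a, 'b) mfps) \<noteq> 1"
  proof
    assume "(0 :: ('a, 'b) mfps) = 1"
    then have "mfps_coeff (0 :: ('a, 'b) mfps) {#} = mfps_coeff 1 {#}" by simp
    then show False by (simp add: zero_mfps_def one_mfps_def)
  qed
  show "f + g + h = f + (g + h)"
    by (rule mfps_eqI) (simp add: plus_mfps_def add.assoc)
  show "f + g = g + f"
    by (simp add: plus_mfps_def add.commute)
  show "0 + f = f"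
    by (rule mfps_eqI) (simp add: plus_mfps_def zero_mfps_def)
  show "- f + f = 0"
    by (rule mfps_eqI) (simp add: plus_mfps_def zero_mfps_def uminus_mfps_def)
  show "f - g = f + - g"
    by (rule mfps_eqI) (simp add: plus_mfps_def uminus_mfps_def minus_mfps_def)
qed

end

instantiation mfps :: (type, comm_ring_1) inverse
begin

definition "inverse f = (if \<exists>g. f * g = 1 then THE g. f * g = 1 else 0)"
  for f :: "('a, 'b) mfps"
definition "f div g = f * inverse g" for f g :: "('a, 'b) mfps"

instance ..

end

definition mfps_const :: "'a::zero \<Rightarrow> ('v, 'a) mfps" where
  "mfps_const c = Abs_mfps (\<lambda>m. if m = {#} then c else 0)"

definition mfps_var :: "'v \<Rightarrow> ('v, 'a::zero_neq_one) mfps" where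
  "mfps_var v = Abs_mfps (\<lambda>m. if m = {#v#} then 1 else 0)"

definition mfps_deriv :: "'v \<Rightarrow> ('v, 'a::semiring_1) mfps \<Rightarrow> ('v, 'a) mfps" where
  "mfps_deriv v f =
     Abs_mfps (\<lambda>m. of_nat (Suc (count m v)) * mfps_coeff f (add_mset v m))"

text \<open>The topology of coefficientwise convergence.\<close>

instantiation mfps :: (type, topological_space) topological_space
begin

definition "open U \<longleftrightarrow> open (Abs_mfps -` U)" for U :: "('a, 'b) mfps set"

instance
  by standard (auto simp: open_mfps_def vimage_Union)

end

lemma open_vimage_eval: "open U \<Longrightarrow> open {h :: 'a \<Rightarrow> 'b::topological_space. h x \<in> U}"
  using open_vimage [OF _ continuous_on_product_coordinates [of x]] by (simp add: vimage_def)

instance "fun" :: (type, t0_space) t0_space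
proof
  fix f g :: "'a \<Rightarrow> 'b"
  assume "f \<noteq> g"
  then obtain x where "f x \<noteq> g x" by auto
  then obtain U where "open U" "\<not> (f x \<in> U \<longleftrightarrow> g x \<in> U)"
    using separation_t0 by metis
  then show "\<exists>U. open U \<and> \<not> (f \<in> U \<longleftrightarrow> g \<in> U)"
    by (intro exI [of _ "{h. h x \<in> U}"]) (auto simp: open_vimage_eval)
qed

instance "fun" :: (type, t1_space) t1_space
proof
  fix f g :: "'a \<Rightarrow> 'b"
  assume "f \<noteq> g"
  then obtain x where "f x \<noteq> g x" by auto
  then obtain U where "open U" "f x \<in> U" "g x \<notin> U"
    using separation_t1 by metis
  then show "\<exists>U. open U \<and> f \<in> U \<and> g \<notin> U"
    by (intro exI [of _ "{h. h x \<in> U}"]) (auto simp: open_vimage_eval)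
qed

instance "fun" :: (type, t2_space) t2_space
proof
  fix f g :: "'a \<Rightarrow> 'b"
  assume "f \<noteq> g"
  then obtain x where "f x \<noteq> g x" by auto
  then obtain U V where "open U" "open V" "f x \<in> U" "g x \<in> V" "U \<inter> V = {}"
    using hausdorff by metis
  then show "\<exists>U V. open U \<and> open V \<and> f \<in> U \<and> g \<in> V \<and> U \<inter> V = {}"
    by (intro exI [of _ "{h. h x \<in> U}"] exI [of _ "{h. h x \<in> V}"])
       (auto simp: open_vimage_eval)
qed

instance mfps :: (type, t2_space) t2_space
proof
  fix f g :: "('a, 'b) mfps"
  assume "f \<noteq> g"
  then have "mfps_coeff f \<noteq> mfps_coeff g" by (simp add: mfps_coeff_inject)
  then obtain U V where "open U" "open V" "mfps_coeff f \<in> U" "mfps_coeff g \<in> V" "U \<inter> V = {}"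
    using hausdorff by metis
  moreover have "Abs_mfps -` (mfps_coeff -` W) = W" for W :: "('a multiset \<Rightarrow> 'b) set"
    by auto
  ultimately show "\<exists>U V. open U \<and> open V \<and> f \<in> U \<and> g \<in> V \<and> U \<inter> V = {}"
    unfolding open_mfps_def
    by (intro exI [of _ "mfps_coeff -` U"] exI [of _ "mfps_coeff -` V"]) auto
qed

definition mfps_exp :: "('v, complex) mfps \<Rightarrow> ('v, complex) mfps" where
  "mfps_exp f = (\<Sum>\<^sub>\<infinity>k\<in>UNIV. mfps_const (1 / fact k) * f ^ k)"

text \<open>
  Elementary Schur polynomials: the coefficient of \<open>w\<^sup>k\<close> in \<open>exp (\<Sum>n\<ge>1. t\<^sub>n w\<^sup>n)\<close>, where \<open>w\<close> is
  the variable of the univariate series and \<open>t 0\<close> is ignored.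
\<close>

definition schur :: "nat \<Rightarrow> (nat \<Rightarrow> ('v, complex) mfps) \<Rightarrow> ('v, complex) mfps" where
  "schur k t = fps_nth
     (Abs_fps (\<lambda>n. mfps_const (1 / fact n)) oo Abs_fps (\<lambda>n. if n = 0 then 0 else t n)) k"


section \<open>The bosonic Fock space\<close>

text \<open>
  The variables are \<open>x\<^sub>n\<close>, \<open>y\<^sub>n\<close> with \<open>n \<ge> 1\<close>: the constructor term \<open>X i\<close> stands for \<open>x\<^sub>i\<^sub>+\<^sub>1\<close>.
  The functions \<open>xv\<close>, \<open>yv\<close>, \<open>dx\<close>, \<open>dy\<close> below take the index \<open>n \<ge> 1\<close> itself; they are never
  used at \<open>0\<close>.
\<close>

datatype var = X nat | Y nat

type_synonym xyser = "(var, complex) mfps"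

definition xv :: "nat \<Rightarrow> xyser" where "xv n = mfps_var (X (n - 1))"
definition yv :: "nat \<Rightarrow> xyser" where "yv n = mfps_var (Y (n - 1))"

text \<open>
  An element \<open>v\<close> of the Fock space is the formal sum of the \<open>v q \<cdot> p\<^sup>q\<close> over all integers \<open>q\<close>.
  Addition and topology on this function type are pointwise.
\<close>

type_synonym fock = "int \<Rightarrow> xyser"

definition fock_embed :: "xyser \<Rightarrow> fock" where
  "fock_embed f = (\<lambda>q. if q = 0 then f else 0)"

definition vac :: fock where "vac = fock_embed 1"

definition fmul :: "xyser \<Rightarrow> fock \<Rightarrow> fock" where
  "fmul f v = (\<lambda>q. f * v q)"

definition scal :: "complex \<Rightarrow> fock \<Rightarrow> fock" where
  "scal c = fmul (mfps_const c)"

definition dx :: "nat \<Rightarrow> fock \<Rightarrow> fock" where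
  "dx n v = (\<lambda>q. mfps_deriv (X (n - 1)) (v q))"

definition dy :: "nat \<Rightarrow> fock \<Rightarrow> fock" where
  "dy n v = (\<lambda>q. mfps_deriv (Y (n - 1)) (v q))"

definition p_power :: "int \<Rightarrow> fock \<Rightarrow> fock" where
  "p_power r v = (\<lambda>q. v (q - r))"

definition p_dp :: "fock \<Rightarrow> fock" where
  "p_dp v = (\<lambda>q. of_int q * v q)"

definition op_exp :: "(fock \<Rightarrow> fock) \<Rightarrow> fock \<Rightarrow> fock" where
  "op_exp A v = (\<Sum>\<^sub>\<infinity>k\<in>UNIV. scal (1 / fact k) ((A ^^ k) v))"


section \<open>Operator-valued formal series in \<open>z\<close> and \<open>z\<^sup>-\<^sup>1\<close>\<close>

text \<open>\<open>F n\<close> is the coefficient of \<open>z\<^sup>n\<close>, for every integer \<open>n\<close>.\<close>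

type_synonym opser = "int \<Rightarrow> fock \<Rightarrow> fock"

definition ser_const :: "(fock \<Rightarrow> fock) \<Rightarrow> opser" where
  "ser_const A = (\<lambda>n. if n = 0 then A else 0)"

text \<open>
  The product of series composes coefficients as operators; the sum over \<open>k\<close> converges
  coefficientwise on each vector.
\<close>

definition ser_mult :: "opser \<Rightarrow> opser \<Rightarrow> opser" (infixr \<open>\<star>\<close> 70) where
  "(F \<star> G) n v = (\<Sum>\<^sub>\<infinity>k\<in>UNIV. F k (G (n - k) v))"

primrec ser_power :: "opser \<Rightarrow> nat \<Rightarrow> opser" where
  "ser_power F 0 = ser_const id"
| "ser_power F (Suc k) = F \<star> ser_power F k"

definition ser_exp :: "opser \<Rightarrow> opser" where
  "ser_exp F n v = (\<Sum>\<^sub>\<infinity>k\<in>UNIV. scal (1 / fact k) (ser_power F k n v))"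

text \<open>\<open>\<Sum>n>0. (x\<^sub>n + y\<^sub>n) z\<^sup>n\<close>\<close>

definition xi :: opser where
  "xi n = (if n > 0 then fmul (xv (nat n) + yv (nat n)) else 0)"

text \<open>\<open>\<Sum>n>0. (\<partial>x\<^sub>n - \<partial>y\<^sub>n) z\<^sup>-\<^sup>n / n\<close>\<close>

definition eta :: opser where
  "eta n = (if n < 0
     then (\<lambda>v. scal (1 / of_int (- n)) (dx (nat (- n)) v - dy (nat (- n)) v)) else 0)"

text \<open>\<open>\<Sum>k>0. k x\<^sub>k z\<^sup>k\<^sup>-\<^sup>1 + \<Sum>k>0. \<partial>x\<^sub>k z\<^sup>-\<^sup>k\<^sup>-\<^sup>1 + p \<partial>p z\<^sup>-\<^sup>1\<close>\<close>

definition current :: opser where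
  "current n =
     (if n \<ge> 0 then fmul (of_int (n + 1) * xv (nat (n + 1)))
      else if n = - 1 then p_dp
      else dx (nat (- n - 1)))"

definition phi_series :: opser where
  "phi_series = ser_const (p_power (- 1)) \<star> ser_exp (- xi) \<star> ser_exp eta"

definition phi_star_series :: opser where
  "phi_star_series = ser_const (p_power 1) \<star> ser_exp xi \<star> current \<star> ser_exp (- eta)"

text \<open>
  The modes are indexed by \<open>\<phi>(z) = \<Sum>i. \<phi>\<^sub>i z\<^sup>-\<^sup>i\<^sup>-\<^sup>1\<close> and \<open>\<phi>\<^sup>*(z) = \<Sum>i. \<phi>\<^sup>*\<^sub>i z\<^sup>-\<^sup>i\<close>.
\<close>

definition phi :: "int \<Rightarrow> fock \<Rightarrow> fock" where
  "phi i = phi_series (- i - 1)"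

definition phi_star :: "int \<Rightarrow> fock \<Rightarrow> fock" where
  "phi_star i = phi_star_series (- i)"

end

theory Submission
  imports Defs
begin

text \<open>
  Put \<open>\<sigma> = \<Sum>j a\<^sub>j S\<^sub>j(-x-y)\<close> and \<open>\<delta> = - \<Sum>j a\<^sub>j S\<^sub>j\<^sub>-\<^sub>1(-x-y)\<close>, and let \<open>A\<close> be the operator in the
  exponential. Since \<open>\<partial>x\<^sub>n - \<partial>y\<^sub>n\<close> kills functions of \<open>x + y\<close>, the vertex operators act explicitly on
  products \<open>S\<^sub>m(-x) g(x+y)\<close>, and \<open>A\<^sup>k 1 = k! E\<^sub>k\<close> with \<open>E\<^sub>k = \<Sum>m\<le>k. S\<^sub>m(-x) (k choose m) \<delta>\<^sup>m \<sigma>\<^sup>k\<^sup>-\<^sup>m\<close>. This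
  follows by induction from the action of \<open>\<phi>\<^sup>*\<^sub>0\<close> on \<open>E\<^sub>k\<close>, where the terms involving \<open>exp (\<Sum>n (x\<^sub>n + y\<^sub>n) z\<^sup>n)\<close>
  cancel because \<open>\<partial>\<sigma>/\<partial>x\<^sub>l = - \<Sum>j a\<^sub>j S\<^sub>j\<^sub>-\<^sub>l(-x-y)\<close>. Summing the \<open>E\<^sub>k\<close> over \<open>k\<close> first at fixed \<open>m\<close> gives
  \<open>\<Sum>m. S\<^sub>m(-x) \<delta>\<^sup>m (1 - \<sigma>)\<^sup>-\<^sup>m\<^sup>-\<^sup>1\<close>, which is the claimed product; all rearrangements are justified by the
  grading in which \<open>x\<^sub>n\<close> and \<open>y\<^sub>n\<close> have weight \<open>n\<close>.
\<close>

unbundle no vec_syntax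
unbundle fps_syntax


subsection \<open>Coefficients and derivations\<close>

lemma mfps_coeff_ring [simp]:
  "mfps_coeff 0 m = 0"
  "mfps_coeff 1 m = (if m = {#} then 1 else 0)"
  "mfps_coeff (f + g) m = mfps_coeff f m + mfps_coeff g m"
  "mfps_coeff (f - g) m = mfps_coeff f m - mfps_coeff g m"
  "mfps_coeff (- f) m = - mfps_coeff f m"
  for f g :: "('v, 'a::comm_ring_1) mfps"
  by (simp_all add: zero_mfps_def one_mfps_def plus_mfps_def minus_mfps_def uminus_mfps_def)

lemma mfps_coeff_mult:
  "mfps_coeff (f * g) m = (\<Sum>b | b \<subseteq># m. mfps_coeff f b * mfps_coeff g (m - b))"
  for f g :: "('v, 'a::comm_ring_1) mfps"
  by (simp add: times_mfps_def)

lemma mfps_coeff_sum: "mfps_coeff (sum f A) m = (\<Sum>i\<in>A. mfps_coeff (f i) m)"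
  for f :: "'i \<Rightarrow> ('v, 'a::comm_ring_1) mfps"
  by (induction A rule: infinite_finite_induct) auto

lemma mfps_coeff_const_mult [simp]: "mfps_coeff (mfps_const c * f) m = c * mfps_coeff f m"
  for f :: "('v, 'a::comm_ring_1) mfps"
proof -
  have "mfps_coeff (mfps_const c * f) m
      = (\<Sum>b | b \<subseteq># m. if b = {#} then c * mfps_coeff f m else 0)"
    unfolding mfps_coeff_mult mfps_const_def mfps_coeff_Abs by (rule sum.cong) auto
  then show ?thesis by (simp add: finite_divisors_mset)
qed

lemma mfps_const_simps:
  "mfps_const (1 :: 'a::comm_ring_1) = (1 :: ('v, 'a) mfps)"
  "mfps_const (0 :: 'a) = (0 :: ('v, 'a) mfps)"
  "mfps_const (a + b) = (mfps_const a + mfps_const b :: ('v, 'a) mfps)"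
  "mfps_const (a * b) = (mfps_const a * mfps_const b :: ('v, 'a) mfps)"
  "mfps_const (- a) = (- mfps_const a :: ('v, 'a) mfps)"
proof -
  show "mfps_const (a * b) = (mfps_const a * mfps_const b :: ('v, 'a) mfps)"
    by (rule mfps_eqI) (simp, simp add: mfps_const_def)
qed (rule mfps_eqI, simp add: mfps_const_def)+

lemma mfps_const_of_nat: "mfps_const (of_nat n) = (of_nat n :: ('v, 'a::comm_ring_1) mfps)"
  by (induction n) (simp_all add: mfps_const_simps)

text \<open>Coefficients are complex, so n can be cancelled in each of them; recursions for n times
  an unknown thereby determine the unknown.\<close>

lemma of_nat_mult_mfps_cancel:
  "of_nat n * f = of_nat n * g \<longleftrightarrow> n = 0 \<or> f = g" for f g :: "('v, complex) mfps"
proof (cases "n = 0")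
  case False
  have "f = g" if "of_nat n * f = of_nat n * g"
  proof (rule mfps_eqI)
    fix m
    have "mfps_coeff (of_nat n * f) m = mfps_coeff (of_nat n * g) m" using that by simp
    then show "mfps_coeff f m = mfps_coeff g m"
      using False by (simp flip: mfps_const_of_nat)
  qed
  then show ?thesis using False by auto
qed simp

lemma mfps_deriv_linear [simp]:
  "mfps_deriv v 0 = 0"
  "mfps_deriv v (f + g) = mfps_deriv v f + mfps_deriv v g"
  "mfps_deriv v (f - g) = mfps_deriv v f - mfps_deriv v g"
  "mfps_deriv v (- f) = - mfps_deriv v f"
  "mfps_deriv v (mfps_const c) = 0"
  for f g :: "('v, 'a::comm_ring_1) mfps"
  by (rule mfps_eqI; simp add: mfps_deriv_def mfps_const_def algebra_simps)+

lemma mfps_deriv_sum: "mfps_deriv v (sum f A) = (\<Sum>i\<in>A. mfps_deriv v (f i))"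
  for f :: "'i \<Rightarrow> ('v, 'a::comm_ring_1) mfps"
  by (induction A rule: infinite_finite_induct) auto

text \<open>The factor \<open>count b v\<close> kills the divisors without v, and the others are
  exactly the \<open>add_mset v b\<close> with b dividing m. This is one half of the Leibniz rule at
  a single coefficient.\<close>

lemma sum_divisors_add_mset:
  fixes F :: "'v multiset \<Rightarrow> 'a::comm_ring_1"
  shows "(\<Sum>b | b \<subseteq># add_mset v m. of_nat (count b v) * F b)
    = (\<Sum>b | b \<subseteq># m. of_nat (Suc (count b v)) * F (add_mset v b))"
proof -
  have "(\<Sum>b | b \<subseteq># add_mset v m. of_nat (count b v) * F b)
      = (\<Sum>b \<in> add_mset v ` {b. b \<subseteq># m}. of_nat (count b v) * F b)"
  proof (rule sum.mono_neutral_right)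
    show "\<forall>b\<in>{b. b \<subseteq># add_mset v m} - add_mset v ` {b. b \<subseteq># m}. of_nat (count b v) * F b = 0"
    proof
      fix b assume b: "b \<in> {b. b \<subseteq># add_mset v m} - add_mset v ` {b. b \<subseteq># m}"
      have "v \<notin># b"
      proof
        assume "v \<in># b"
        then obtain c where "b = add_mset v c" by (metis insert_DiffM)
        with b show False by auto
      qed
      then show "of_nat (count b v) * F b = 0" by (simp add: not_in_iff)
    qed
  qed (auto simp: finite_divisors_mset)
  also have "\<dots> = (\<Sum>b | b \<subseteq># m. of_nat (Suc (count b v)) * F (add_mset v b))"
    by (subst sum.reindex) (auto simp: inj_on_def)
  finally show ?thesis .
qed

lemma mset_diff_diff_sub: "b \<subseteq># m \<Longrightarrow> m - (m - b) = b"
  by (auto simp: subset_mset.le_iff_add)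

lemma mfps_deriv_mult [simp]:
  "mfps_deriv v (f * g) = mfps_deriv v f * g + f * mfps_deriv v g"
  for f g :: "('v, 'a::comm_ring_1) mfps"
proof -
  have half: "(\<Sum>b | b \<subseteq># add_mset v m. of_nat (count b v) * (mfps_coeff f b * mfps_coeff g (add_mset v m - b)))
      = mfps_coeff (mfps_deriv v f * g) m" for f g :: "('v, 'a) mfps" and m
    unfolding sum_divisors_add_mset by (simp add: mfps_coeff_mult mfps_deriv_def mult.assoc)
  show ?thesis
  proof (rule mfps_eqI)
    fix m :: "'v multiset"
    let ?M = "add_mset v m"
    let ?F = "\<lambda>b. mfps_coeff f b * mfps_coeff g (?M - b)"
    have "mfps_coeff (mfps_deriv v (f * g)) m = (\<Sum>b | b \<subseteq># ?M. of_nat (count ?M v) * ?F b)"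
      by (simp add: mfps_deriv_def mfps_coeff_mult sum_distrib_left)
    \<comment> \<open>The exponent of v in \<open>?M\<close> is the sum of its exponents in b and in
      \<open>?M - b\<close>; the first share differentiates f, the second g.\<close>
    also have "\<dots> = (\<Sum>b | b \<subseteq># ?M. of_nat (count b v) * ?F b + of_nat (count (?M - b) v) * ?F b)"
    proof (rule sum.cong)
      fix b assume "b \<in> {b. b \<subseteq># ?M}"
      then have "count b v \<le> count ?M v" by (simp only: mem_Collect_eq subseteq_mset_def)
      then have "count ?M v = count b v + count (?M - b) v" by simp
      then have e: "(of_nat (count ?M v) :: 'a) = of_nat (count b v) + of_nat (count (?M - b) v)"
        by (metis of_nat_add)
      show "of_nat (count ?M v) * ?F b = of_nat (count b v) * ?F b + of_nat (count (?M - b) v) * ?F b"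
        unfolding e by (simp only: distrib_right)
    qed simp
    also have "\<dots> = (\<Sum>b | b \<subseteq># ?M. of_nat (count b v) * ?F b)
        + (\<Sum>b | b \<subseteq># ?M. of_nat (count (?M - b) v) * ?F b)"
      by (rule sum.distrib)
    also have "(\<Sum>b | b \<subseteq># ?M. of_nat (count (?M - b) v) * ?F b)
        = (\<Sum>b | b \<subseteq># ?M. of_nat (count b v) * (mfps_coeff g b * mfps_coeff f (?M - b)))"
      by (rule sum.reindex_bij_witness [where i = "\<lambda>b. ?M - b" and j = "\<lambda>b. ?M - b"])
         (auto simp: mset_diff_diff_sub mult.commute)
    finally show "mfps_coeff (mfps_deriv v (f * g)) m
        = mfps_coeff (mfps_deriv v f * g + f * mfps_deriv v g) m"
      unfolding half by (simp add: mult.commute)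
  qed
qed

lemma mfps_deriv_1 [simp]: "mfps_deriv v (1 :: ('v, 'a::comm_ring_1) mfps) = 0"
  by (metis mfps_const_simps(1) mfps_deriv_linear(5))

lemma mfps_deriv_of_nat [simp]: "mfps_deriv v (of_nat n :: ('v, 'a::comm_ring_1) mfps) = 0"
  by (metis mfps_const_of_nat mfps_deriv_linear(5))

lemma mfps_deriv_power:
  "mfps_deriv v (f ^ n) = of_nat n * f ^ (n - 1) * mfps_deriv v f"
  for f :: "('v, 'a::comm_ring_1) mfps"
proof (induction n)
  case (Suc n)
  then show ?case by (cases n) (simp_all add: algebra_simps)
qed simp

lemma mfps_deriv_var:
  "mfps_deriv v (mfps_var w :: ('v, 'a::comm_ring_1) mfps) = (if v = w then 1 else 0)"
  by (rule mfps_eqI) (auto simp: mfps_deriv_def mfps_var_def)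

subsection \<open>Elementary Schur polynomials\<close>

lemma fps_power_nth_0:
  assumes "T $ 0 = 0" "n < k" shows "((T :: 'a::comm_ring_1 fps) ^ k) $ n = 0"
  using assms(2)
proof (induction k arbitrary: n)
  case (Suc k)
  have "T $ i * (T ^ k) $ (n - i) = 0" if "i \<in> {0..n}" for i
    using assms(1) Suc that by (cases i) auto
  then show ?case by (simp add: fps_mult_nth)
qed simp

text \<open>The exponent T of the series exp(T) inside \<open>schur\<close>, with the auxiliary
  variable w as its variable and \<open>t 0\<close> discarded.\<close>

definition fps_arg :: "(nat \<Rightarrow> ('v, complex) mfps) \<Rightarrow> ('v, complex) mfps fps" where
  "fps_arg t = Abs_fps (\<lambda>n. if n = 0 then 0 else t n)"

text \<open>T has no constant term, so T^k starts in degree k and the exponential series may be cut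
  at any N above n. A free N gives a common range when sums are exchanged.\<close>

lemma schur_sum:
  assumes "n \<le> N"
  shows "schur n t = (\<Sum>k\<le>N. mfps_const (1 / fact k) * (fps_arg t ^ k) $ n)"
proof -
  have "schur n t = (\<Sum>k\<in>{..n}. mfps_const (1 / fact k) * (fps_arg t ^ k) $ n)"
    by (simp add: schur_def fps_compose_nth fps_arg_def atLeast0AtMost)
  also have "\<dots> = (\<Sum>k\<le>N. mfps_const (1 / fact k) * (fps_arg t ^ k) $ n)"
    using assms by (intro sum.mono_neutral_left) (auto simp: fps_power_nth_0 fps_arg_def)
  finally show ?thesis .
qed

lemma schur_0 [simp]: "schur 0 t = 1"
  by (simp add: schur_sum [of 0 0] mfps_const_simps)

text \<open>Compare coefficients of w^(n-1) in (exp T)' = T' exp T. The summand k = 0 drops out and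
  the chain rule turns 1/(k+1)! into 1/k!.\<close>

lemma schur_rec:
  "of_nat n * schur n t = (\<Sum>l=1..n. of_nat l * t l * schur (n - l) t)"
proof (cases n)
  case (Suc N)
  let ?T = "fps_arg t" and ?c = "\<lambda>k. mfps_const (1 / fact k) :: ('a, complex) mfps"
  have cS: "?c (Suc k) * of_nat (Suc k) = ?c k" for k
  proof -
    have "(1 / fact (Suc k) :: complex) * of_nat (Suc k) = 1 / fact k"
      by (simp del: of_nat_Suc)
    then show ?thesis by (metis mfps_const_of_nat mfps_const_simps(4))
  qed
  have "of_nat n * schur n t = (\<Sum>k\<le>Suc N. ?c k * fps_deriv (?T ^ k) $ N)"
    unfolding Suc schur_sum [OF order_refl, of "Suc N"] fps_deriv_nth sum_distrib_left
    by (simp only: Suc_eq_plus1 mult.left_commute)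
  also have "\<dots> = (\<Sum>k\<le>N. ?c (Suc k) * fps_deriv (?T ^ Suc k) $ N)"
    by (subst sum.atMost_Suc_shift) simp
  also have "\<dots> = (\<Sum>k\<le>N. ?c k * (fps_deriv ?T * ?T ^ k) $ N)"
  proof (rule sum.cong)
    fix k
    have "fps_deriv (?T ^ Suc k) = of_nat (Suc k) * (fps_deriv ?T * ?T ^ k)"
      by (subst fps_deriv_power') simp
    then have "fps_deriv (?T ^ Suc k) $ N = of_nat (Suc k) * (fps_deriv ?T * ?T ^ k) $ N"
      by (simp del: of_nat_Suc add: fps_of_nat [symmetric])
    then show "?c (Suc k) * fps_deriv (?T ^ Suc k) $ N = ?c k * (fps_deriv ?T * ?T ^ k) $ N"
      using cS [of k] by (metis mult.assoc)
  qed simp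
  also have "\<dots> = (\<Sum>k\<le>N. \<Sum>i=0..N. fps_deriv ?T $ i * (?c k * (?T ^ k) $ (N - i)))"
    by (simp add: fps_mult_nth sum_distrib_left mult.left_commute)
  also have "\<dots> = (\<Sum>i=0..N. \<Sum>k\<le>N. fps_deriv ?T $ i * (?c k * (?T ^ k) $ (N - i)))"
    by (rule sum.swap)
  also have "\<dots> = (\<Sum>i=0..N. fps_deriv ?T $ i * schur (N - i) t)"
    by (simp add: schur_sum [of "N - _" N] sum_distrib_left)
  also have "\<dots> = (\<Sum>i=0..N. of_nat (Suc i) * t (Suc i) * schur (n - Suc i) t)"
    by (simp add: fps_arg_def Suc)
  also have "\<dots> = (\<Sum>l=Suc 0..Suc N. of_nat l * t l * schur (n - l) t)"
    by (subst sum.atLeast_Suc_atMost_Suc_shift) simp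
  finally show ?thesis by (simp add: Suc)
qed simp

text \<open>Dividing the recursion by n determines the sequence from its value at 0, so later
  identities need not return to the exponential.\<close>

lemma schur_unique:
  assumes "g 0 = 1" "\<And>n. n > 0 \<Longrightarrow> of_nat n * g n = (\<Sum>l=1..n. of_nat l * t l * g (n - l))"
  shows "g n = schur n t"
proof (induction n rule: less_induct)
  case (less n)
  show ?case
  proof (cases "n = 0")
    case False
    then have "of_nat n * g n = of_nat n * schur n t"
      unfolding schur_rec assms(2) [OF False [unfolded neq0_conv]]
      by (intro sum.cong) (use less in auto)
    then show ?thesis using False by (simp add: of_nat_mult_mfps_cancel)
  qed (simp add: assms)
qed

lemma fps_deriv_schur:
  "fps_deriv (Abs_fps (\<lambda>n. schur n t)) = fps_deriv (fps_arg t) * Abs_fps (\<lambda>n. schur n t)"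
proof (rule fps_ext)
  fix n
  have "fps_deriv (Abs_fps (\<lambda>n. schur n t)) $ n = of_nat (Suc n) * schur (Suc n) t"
    by simp
  also have "\<dots> = (\<Sum>i=0..n. of_nat (Suc i) * t (Suc i) * schur (n - i) t)"
    unfolding schur_rec One_nat_def by (subst sum.atLeast_Suc_atMost_Suc_shift) simp
  also have "\<dots> = (fps_deriv (fps_arg t) * Abs_fps (\<lambda>n. schur n t)) $ n"
    by (simp add: fps_mult_nth fps_arg_def)
  finally show "fps_deriv (Abs_fps (\<lambda>n. schur n t)) $ n
      = (fps_deriv (fps_arg t) * Abs_fps (\<lambda>n. schur n t)) $ n" .
qed

text \<open>This is exp(T) exp(-T) = 1: the derivative of the product is (T' - T') times the
  product, hence 0.\<close>

lemma schur_uminus_convolution: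
  assumes "n > 0"
  shows "(\<Sum>l=0..n. schur l t * schur (n - l) (\<lambda>n. - t n)) = 0"
proof -
  let ?E = "Abs_fps (\<lambda>n. schur n t)" and ?H = "Abs_fps (\<lambda>n. schur n (\<lambda>n. - t n))"
  have "fps_arg (\<lambda>n. - t n) = - fps_arg t"
    by (rule fps_ext) (simp add: fps_arg_def)
  then have "fps_deriv (?E * ?H) = 0"
    by (simp add: fps_deriv_schur algebra_simps)
  moreover obtain m where "n = Suc m" using assms by (cases n) auto
  ultimately have "of_nat n * (?E * ?H) $ n = of_nat n * 0"
    by (metis Suc_eq_plus1 fps_deriv_nth fps_zero_nth mult_zero_right)
  then show ?thesis
    using assms by (simp only: of_nat_mult_mfps_cancel fps_mult_nth) simp
qed

text \<open>Extension by 0 to integer indices, so that index shifts by lowering operators need no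
  case distinction.\<close>

definition schurz :: "(nat \<Rightarrow> ('v, complex) mfps) \<Rightarrow> int \<Rightarrow> ('v, complex) mfps" where
  "schurz t k = (if k < 0 then 0 else schur (nat k) t)"

lemma schurz_of_nat [simp]: "schurz t (int n) = schur n t"
  by (simp add: schurz_def)

lemma schurz_0 [simp]: "schurz t 0 = 1"
  by (simp add: schurz_def)

lemma schurz_neg [simp]: "k < 0 \<Longrightarrow> schurz t k = 0"
  by (simp add: schurz_def)

text \<open>The range may exceed k because its extra terms have negative index; for k at most 0 both
  sides vanish.\<close>

lemma schurz_rec:
  assumes "k \<le> int N"
  shows "(\<Sum>l=1..N. of_nat l * t l * schurz t (k - int l)) = of_int k * schurz t k"
proof (cases "k > 0")
  case True
  then obtain n where n: "k = int n" "n > 0" using zero_less_imp_eq_int by blast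
  have "(\<Sum>l=1..N. of_nat l * t l * schurz t (k - int l))
      = (\<Sum>l=1..n. of_nat l * t l * schurz t (k - int l))"
    using assms n by (intro sum.mono_neutral_right) auto
  also have "\<dots> = (\<Sum>l=1..n. of_nat l * t l * schur (n - l) t)"
    by (intro sum.cong) (auto simp: n simp flip: of_nat_diff)
  finally show ?thesis by (simp add: n schur_rec)
next
  case False
  then show ?thesis by (cases "k = 0") auto
qed

text \<open>A derivation with dT = c w^d satisfies d(exp T) = c w^d exp T. The coefficients of this
  identity follow by induction from the recursion.\<close>

lemma mfps_deriv_schurz:
  assumes d: "d > 0" and t: "\<And>l. l > 0 \<Longrightarrow> mfps_deriv v (t l) = (if l = d then c else 0)"
  shows "mfps_deriv v (schurz t k) = c * schurz t (k - int d)"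
proof (cases "k < 0")
  case False
  have "mfps_deriv v (schur n t) = c * schurz t (int n - int d)" for n
  proof (induction n rule: less_induct)
    case (less n)
    show ?case
    proof (cases "n = 0")
      case False
      have "of_nat n * mfps_deriv v (schur n t) = mfps_deriv v (of_nat n * schur n t)"
        by simp
      also have "\<dots> = (\<Sum>l=1..n. of_nat l * mfps_deriv v (t l) * schur (n - l) t)
          + (\<Sum>l=1..n. of_nat l * t l * mfps_deriv v (schur (n - l) t))"
        unfolding schur_rec mfps_deriv_sum by (simp add: sum.distrib)
      also have "(\<Sum>l=1..n. of_nat l * mfps_deriv v (t l) * schur (n - l) t)
          = (\<Sum>l=1..n. if l = d then of_nat d * c * schur (n - d) t else 0)"
        by (intro sum.cong) (auto simp: t)
      also have "\<dots> = of_nat d * c * schurz t (int n - int d)"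
        using d by (cases "d \<le> n") (auto simp flip: of_nat_diff)
      also have "(\<Sum>l=1..n. of_nat l * t l * mfps_deriv v (schur (n - l) t))
          = (\<Sum>l=1..n. c * (of_nat l * t l * schurz t ((int n - int d) - int l)))"
        using False by (intro sum.cong) (auto simp: less algebra_simps of_nat_diff)
      also have "\<dots> = c * (of_int (int n - int d) * schurz t (int n - int d))"
        unfolding sum_distrib_left [symmetric] by (subst schurz_rec) auto
      \<comment> \<open>The differentiated \<open>t l\<close> contribute the factor d and the
        induction hypothesis contributes n - d, so together they give n, which cancels.\<close>
      finally have "of_nat n * mfps_deriv v (schur n t) = of_nat n * (c * schurz t (int n - int d))"
        by (simp add: algebra_simps)
      then show ?thesis using False by (simp add: of_nat_mult_mfps_cancel)
    qed (use d in simp)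
  qed
  moreover obtain n where "k = int n" using False zero_le_imp_eq_int by (metis linorder_not_le)
  ultimately show ?thesis by simp
qed (use d in simp)

subsection \<open>Vectors concentrated in one power of \<open>p\<close>\<close>

text \<open>The vector f p^q. All vectors met below have this form, and every operator sends such a
  vector to another.\<close>

definition emb :: "int \<Rightarrow> xyser \<Rightarrow> fock" where
  "emb q f = (\<lambda>r. if r = q then f else 0)"

lemma emb_add: "emb q (f + g) = emb q f + emb q g"
  by (auto simp: emb_def fun_eq_iff)

lemma emb_diff: "emb q (f - g) = emb q f - emb q g"
  by (auto simp: emb_def fun_eq_iff)

lemma emb_uminus: "emb q (- f) = - emb q f"
  by (auto simp: emb_def fun_eq_iff)

lemma emb_0 [simp]: "emb q 0 = 0"
  by (auto simp: emb_def fun_eq_iff)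

lemma emb_sum: "emb q (sum f A) = (\<Sum>i\<in>A. emb q (f i))"
  by (induction A rule: infinite_finite_induct) (auto simp: emb_add)

lemma fmul_emb [simp]: "fmul g (emb q f) = emb q (g * f)"
  by (auto simp: emb_def fmul_def fun_eq_iff)

lemma scal_emb [simp]: "scal c (emb q f) = emb q (mfps_const c * f)"
  by (simp add: scal_def)

lemma dx_emb [simp]: "dx n (emb q f) = emb q (mfps_deriv (X (n - 1)) f)"
  by (auto simp: emb_def dx_def fun_eq_iff)

lemma dy_emb [simp]: "dy n (emb q f) = emb q (mfps_deriv (Y (n - 1)) f)"
  by (auto simp: emb_def dy_def fun_eq_iff)

lemma p_power_emb [simp]: "p_power r (emb q f) = emb (q + r) f"
  by (auto simp: emb_def p_power_def fun_eq_iff)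

lemma p_dp_emb [simp]: "p_dp (emb q f) = emb q (of_int q * f)"
  by (auto simp: emb_def p_dp_def fun_eq_iff)

lemma fock_operators_0 [simp]:
  "fmul f 0 = 0" "scal c 0 = 0" "dx n 0 = 0" "dy n 0 = 0" "p_dp 0 = 0" "p_power r 0 = 0"
  by (auto simp: fmul_def scal_def dx_def dy_def p_dp_def p_power_def fun_eq_iff)

subsection \<open>Series of operators\<close>

text \<open>Reduces the infinite sums in operator products and exponentials to finite ones;
  \<open>g\<close> translates natural numbers into the integer exponents that contribute.\<close>

lemma infsum_finite_support:
  fixes f :: "'a \<Rightarrow> 'b::{comm_monoid_add, t2_space}"
  assumes "finite A" "inj_on g A" "\<And>k. k \<notin> g ` A \<Longrightarrow> f k = 0"
  shows "(\<Sum>\<^sub>\<infinity>k\<in>UNIV. f k) = (\<Sum>a\<in>A. f (g a))"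
proof -
  have "(\<Sum>\<^sub>\<infinity>k\<in>UNIV. f k) = (\<Sum>\<^sub>\<infinity>k\<in>g ` A. f k)"
    using assms by (intro infsum_cong_neutral) auto
  also have "\<dots> = (\<Sum>a\<in>A. f (g a))"
    using assms by (simp add: sum.reindex)
  finally show ?thesis .
qed

lemma ser_const_mult: "(ser_const A \<star> F) n v = A (F n v)"
  unfolding ser_mult_def
  by (subst infsum_finite_support [where A = "{0}" and g = id]) (auto simp: ser_const_def)

text \<open>Treats raising and lowering series together: \<epsilon> is the sign of the exponents of
  z. If each \<open>F (\<epsilon> * int n)\<close> shifts the index of \<open>W\<close> by n and
  multiplies by \<open>C $ n\<close>, then F behaves like the scalar series C, and its powers like
  those of C. The hypothesis \<open>act\<close> speaks only of coefficients of powers of C times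
  \<open>f\<close>, for which the lowering operators can be controlled.\<close>

lemma ser_power_action:
  fixes F :: opser and Z :: "'i \<Rightarrow> nat \<Rightarrow> xyser" and \<epsilon> q :: int and I :: "'i set"
  defines "W \<equiv> \<lambda>i f. emb q (\<Sum>\<iota>\<in>I. Z \<iota> i * f \<iota>)"
  assumes eps: "\<epsilon> = 1 \<or> \<epsilon> = - 1" and C0: "C $ 0 = 0"
    and F0: "\<And>n v. \<epsilon> * n \<le> 0 \<Longrightarrow> F n v = 0" and Fz: "\<And>n. F n 0 = 0"
    and act: "\<And>n i k m. n > 0 \<Longrightarrow> F (\<epsilon> * int n) (W i (\<lambda>\<iota>. (C ^ k) $ m * f \<iota>))
        = W (i + n) (\<lambda>\<iota>. C $ n * ((C ^ k) $ m * f \<iota>))"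
  shows "ser_power F k (\<epsilon> * int n) (W 0 f) = W n (\<lambda>\<iota>. (C ^ k) $ n * f \<iota>)"
    and "\<epsilon> * N < 0 \<Longrightarrow> ser_power F k N (W 0 f) = 0"
proof (induction k arbitrary: n N)
  case 0
  {
    case 1
    show ?case using eps by (auto simp: ser_const_def W_def)
  next
    case 2
    then show ?case by (auto simp: ser_const_def)
  }
next
  case (Suc k)
  have S: "ser_power F (Suc k) N (W 0 f) = (\<Sum>\<^sub>\<infinity>l\<in>UNIV. F l (ser_power F k (N - l) (W 0 f)))" for N
    by (simp add: ser_mult_def)
  {
    case 1
    \<comment> \<open>Only exponents of absolute value 1 to n and sign \<epsilon> contribute: F
      vanishes on the other sign, and beyond n the remaining exponent has the wrong sign for the
      induction hypothesis.\<close>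
    have "ser_power F (Suc k) (\<epsilon> * int n) (W 0 f)
        = (\<Sum>l\<in>{1..n}. F (\<epsilon> * int l) (ser_power F k (\<epsilon> * int n - \<epsilon> * int l) (W 0 f)))"
      unfolding S
    proof (rule infsum_finite_support)
      show "inj_on (\<lambda>l. \<epsilon> * int l) {1..n}" using eps by (auto simp: inj_on_def)
      fix l assume l: "l \<notin> (\<lambda>l. \<epsilon> * int l) ` {1..n}"
      show "F l (ser_power F k (\<epsilon> * int n - l) (W 0 f)) = 0"
      proof (cases "\<epsilon> * l \<le> 0")
        case False
        have "\<epsilon> * l > int n"
        proof (rule ccontr)
          assume "\<not> \<epsilon> * l > int n"
          with False have "l = \<epsilon> * int (nat (\<epsilon> * l))" "nat (\<epsilon> * l) \<in> {1..n}" using eps by auto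
          with l show False by blast
        qed
        then have "\<epsilon> * (\<epsilon> * int n - l) < 0" using eps by auto
        then show ?thesis by (simp only: Suc.IH Fz)
      qed (rule F0)
    qed simp
    also have "\<dots> = (\<Sum>l\<in>{1..n}. W n (\<lambda>\<iota>. C $ l * ((C ^ k) $ (n - l) * f \<iota>)))"
    proof (rule sum.cong)
      fix l assume l: "l \<in> {1..n}"
      then have e: "\<epsilon> * int n - \<epsilon> * int l = \<epsilon> * int (n - l)"
        by (simp add: of_nat_diff right_diff_distrib)
      have "F (\<epsilon> * int l) (W (n - l) (\<lambda>\<iota>. (C ^ k) $ (n - l) * f \<iota>))
          = W (n - l + l) (\<lambda>\<iota>. C $ l * ((C ^ k) $ (n - l) * f \<iota>))"
        using l by (intro act) simp
      then show "F (\<epsilon> * int l) (ser_power F k (\<epsilon> * int n - \<epsilon> * int l) (W 0 f))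
          = W n (\<lambda>\<iota>. C $ l * ((C ^ k) $ (n - l) * f \<iota>))"
        unfolding Suc.IH(1) e using l by simp
    qed simp
    also have "\<dots> = W n (\<lambda>\<iota>. (\<Sum>l=1..n. C $ l * (C ^ k) $ (n - l)) * f \<iota>)"
      unfolding W_def emb_sum [symmetric] sum_distrib_left sum_distrib_right
      by (subst sum.swap) (simp only: mult.assoc)
    also have "(\<Sum>l=1..n. C $ l * (C ^ k) $ (n - l)) = (C ^ Suc k) $ n"
      by (simp add: fps_mult_nth sum.atLeast_Suc_atMost [of 0] C0)
    finally show ?case .
  next
    case 2
    have "F l (ser_power F k (N - l) (W 0 f)) = 0" for l
    proof (cases "\<epsilon> * l \<le> 0")
      case False
      then have "\<epsilon> * (N - l) < 0" using 2 by (simp add: right_diff_distrib)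
      then show ?thesis by (simp only: Suc.IH Fz)
    qed (rule F0)
    then show ?case by (simp only: S infsum_0)
  }
qed

text \<open>Summing the powers of C with weights 1/k! gives exp C, whose coefficients are the Schur
  polynomials of c.\<close>

lemma ser_exp_action:
  fixes F :: opser and Z :: "'i \<Rightarrow> nat \<Rightarrow> xyser" and \<epsilon> q :: int and I :: "'i set"
  defines "W \<equiv> \<lambda>i f. emb q (\<Sum>\<iota>\<in>I. Z \<iota> i * f \<iota>)"
  assumes eps: "\<epsilon> = 1 \<or> \<epsilon> = - 1"
    and F0: "\<And>n v. \<epsilon> * n \<le> 0 \<Longrightarrow> F n v = 0" and Fz: "\<And>n. F n 0 = 0"
    and act: "\<And>n i k m. n > 0 \<Longrightarrow> F (\<epsilon> * int n) (W i (\<lambda>\<iota>. (fps_arg c ^ k) $ m * f \<iota>))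
        = W (i + n) (\<lambda>\<iota>. c n * ((fps_arg c ^ k) $ m * f \<iota>))"
  shows "ser_exp F (\<epsilon> * int n) (W 0 f) = W n (\<lambda>\<iota>. schur n c * f \<iota>)"
    and "\<epsilon> * N < 0 \<Longrightarrow> ser_exp F N (W 0 f) = 0"
proof -
  have act': "F (\<epsilon> * int n) (W i (\<lambda>\<iota>. (fps_arg c ^ k) $ m * f \<iota>))
        = W (i + n) (\<lambda>\<iota>. fps_arg c $ n * ((fps_arg c ^ k) $ m * f \<iota>))" if "n > 0" for n i k m
  proof -
    have "fps_arg c $ n = c n" using that by (simp add: fps_arg_def)
    then show ?thesis by (simp only: act [OF that])
  qed
  have C0: "fps_arg c $ 0 = 0" by (simp add: fps_arg_def)
  have pow: "ser_power F k (\<epsilon> * int n) (W 0 f) = W n (\<lambda>\<iota>. (fps_arg c ^ k) $ n * f \<iota>)"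
    "\<epsilon> * N < 0 \<Longrightarrow> ser_power F k N (W 0 f) = 0" for k n N
    unfolding W_def
    by (rule ser_power_action [OF eps C0 F0 Fz act' [unfolded W_def]]; assumption)+
  have "ser_exp F (\<epsilon> * int n) (W 0 f)
      = (\<Sum>k\<in>{..n}. scal (1 / fact (id k)) (W n (\<lambda>\<iota>. (fps_arg c ^ id k) $ n * f \<iota>)))"
    unfolding ser_exp_def pow(1)
  proof (subst infsum_finite_support [where A = "{..n}" and g = id])
    fix k assume "k \<notin> id ` {..n}"
    then have "(fps_arg c ^ k) $ n = 0" by (intro fps_power_nth_0 C0) auto
    then show "scal (1 / fact k) (W n (\<lambda>\<iota>. (fps_arg c ^ k) $ n * f \<iota>)) = 0"
      by (simp add: W_def)
  qed simp_all
  also have "\<dots> = W n (\<lambda>\<iota>. schur n c * f \<iota>)"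
    unfolding W_def schur_sum [OF order_refl] scal_emb emb_sum [symmetric]
      sum_distrib_left sum_distrib_right
    by (subst sum.swap) (simp add: ac_simps)
  finally show "ser_exp F (\<epsilon> * int n) (W 0 f) = W n (\<lambda>\<iota>. schur n c * f \<iota>)" .
  assume "\<epsilon> * N < 0"
  then show "ser_exp F N (W 0 f) = 0"
    by (simp only: ser_exp_def pow(2) fock_operators_0 infsum_0)
qed

subsection \<open>Action of the vertex operators\<close>

text \<open>The case of a one-element index set with \<open>Z\<close> constantly 1, where the shift
  is invisible and only the scalar series remains.\<close>

lemma ser_exp_mult:
  assumes F: "F = (\<lambda>n. if n > 0 then fmul (t (nat n)) else 0)"
  shows "ser_exp F k (emb q f) = emb q (schurz t k * f)"
proof -
  have eps: "(1::int) = 1 \<or> (1::int) = - 1" by simp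
  have F0: "F n v = 0" if "1 * n \<le> 0" for n v using that by (simp add: F)
  have Fz: "F n 0 = 0" for n by (simp add: F)
  have act: "F (1 * int n) (emb q (\<Sum>_\<in>{()}. 1 * ((fps_arg t ^ k) $ m * f)))
      = emb q (\<Sum>_\<in>{()}. 1 * (t n * ((fps_arg t ^ k) $ m * f)))" if "n > 0" for n k m
    using that by (simp add: F)
  note * = ser_exp_action [where Z = "\<lambda>_ _. 1" and f = "\<lambda>_. f", OF eps F0 Fz act]
  show ?thesis
  proof (cases "k < 0")
    case True
    then show ?thesis using *(2) [of k] by simp
  next
    case False
    then obtain n where "k = int n" using zero_le_imp_eq_int by (metis linorder_not_le)
    then show ?thesis using *(1) [of n] by simp
  qed
qed

lemma ser_exp_xi: "ser_exp xi k (emb q f) = emb q (schurz (\<lambda>n. xv n + yv n) k * f)"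
  by (rule ser_exp_mult) (auto simp: xi_def)

lemma ser_exp_minus_xi: "ser_exp (- xi) k (emb q f) = emb q (schurz (\<lambda>n. - xv n - yv n) k * f)"
proof (rule ser_exp_mult, rule ext)
  fix n
  have "- fmul g = fmul (- g)" for g
    by (simp add: fun_eq_iff fmul_def)
  then show "(- xi) n = (if n > 0 then fmul (- xv (nat n) - yv (nat n)) else 0)"
    by (simp add: xi_def)
qed

abbreviation Sx :: "int \<Rightarrow> xyser" where "Sx \<equiv> schurz (\<lambda>n. - xv n)"
abbreviation Su :: "int \<Rightarrow> xyser" where "Su \<equiv> schurz (\<lambda>n. - xv n - yv n)"
text \<open>The generating series of \<open>Hu\<close> and \<open>Su\<close> are inverse to each
  other.\<close>

abbreviation Hu :: "int \<Rightarrow> xyser" where "Hu \<equiv> schurz (\<lambda>n. xv n + yv n)"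

section \<open>Derivatives of \<open>Sx\<close> and \<open>Su\<close>\<close>

lemma mfps_deriv_xv: "l > 0 \<Longrightarrow> mfps_deriv (X i) (xv l) = (if l = Suc i then 1 else 0)"
  "l > 0 \<Longrightarrow> mfps_deriv (Y i) (yv l) = (if l = Suc i then 1 else 0)"
  "mfps_deriv (Y i) (xv l) = 0" "mfps_deriv (X i) (yv l) = 0"
  by (auto simp: xv_def yv_def mfps_deriv_var)

lemma deriv_Sx [simp]:
  "mfps_deriv (X i) (Sx k) = - Sx (k - int (Suc i))"
  "mfps_deriv (Y i) (Sx k) = 0"
  using mfps_deriv_schurz [of "Suc i" "X i" "\<lambda>n. - xv n" "-1" k]
    mfps_deriv_schurz [of "Suc i" "Y i" "\<lambda>n. - xv n" 0 k]
  by (auto simp: mfps_deriv_xv)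

lemma deriv_Su [simp]:
  "mfps_deriv (X i) (Su k) = - Su (k - int (Suc i))"
  "mfps_deriv (Y i) (Su k) = - Su (k - int (Suc i))"
  using mfps_deriv_schurz [of "Suc i" "X i" "\<lambda>n. - xv n - yv n" "-1" k]
    mfps_deriv_schurz [of "Suc i" "Y i" "\<lambda>n. - xv n - yv n" "-1" k]
  by (auto simp: mfps_deriv_xv)

text \<open>Functions of the \<open>x\<^sub>n + y\<^sub>n\<close> alone, on which \<open>\<partial>x\<^sub>n - \<partial>y\<^sub>n\<close> vanishes.\<close>

definition ufun :: "xyser \<Rightarrow> bool" where
  "ufun g \<longleftrightarrow> (\<forall>i. mfps_deriv (X i) g = mfps_deriv (Y i) g)"

lemma ufun_const [simp]: "ufun (mfps_const c)" by (simp add: ufun_def)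
lemma ufun_of_nat [simp]: "ufun (of_nat n)" by (simp add: ufun_def)
lemma ufun_0 [simp]: "ufun 0" by (simp add: ufun_def)
lemma ufun_1 [simp]: "ufun 1" by (simp add: ufun_def)
lemma ufun_minus [simp]: "ufun f \<Longrightarrow> ufun (- f)" by (simp add: ufun_def)
lemma ufun_mult [simp]: "ufun f \<Longrightarrow> ufun g \<Longrightarrow> ufun (f * g)" by (simp add: ufun_def)
lemma ufun_power [simp]: "ufun f \<Longrightarrow> ufun (f ^ n)" by (induction n) auto
lemma ufun_Su [simp]: "ufun (Su k)" by (simp add: ufun_def)
lemma ufun_sum [simp]: "(\<And>i. i \<in> A \<Longrightarrow> ufun (f i)) \<Longrightarrow> ufun (sum f A)"
  by (simp add: ufun_def mfps_deriv_sum)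

lemma ufun_fps_power: "(\<And>n. ufun (C $ n)) \<Longrightarrow> ufun ((C ^ k) $ m)"
  by (induction k arbitrary: m) (auto simp: fps_mult_nth fps_one_nth)

text \<open>On products \<open>S\<^sub>m(-x) g(x + y)\<close> the operator \<open>(\<partial>x\<^sub>n - \<partial>y\<^sub>n) / n\<close> lowers \<open>m\<close> by \<open>n\<close>.\<close>

lemma ser_exp_lowering:
  assumes F: "F = (\<lambda>n. if n < 0
      then (\<lambda>v. scal (b / of_int (- n)) (dx (nat (- n)) v - dy (nat (- n)) v)) else 0)"
    and f: "\<And>\<iota>. \<iota> \<in> I \<Longrightarrow> ufun (f \<iota>)"
  shows "ser_exp F (- k) (emb q (\<Sum>\<iota>\<in>I. Sx (\<mu> \<iota>) * f \<iota>))
    = emb q (schurz (\<lambda>n. mfps_const (- b / of_nat n)) k * (\<Sum>\<iota>\<in>I. Sx (\<mu> \<iota> - k) * f \<iota>))"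
proof -
  define c :: "nat \<Rightarrow> xyser" where "c = (\<lambda>n. mfps_const (- b / of_nat n))"
  have eps: "(- 1::int) = 1 \<or> (- 1::int) = - 1" by simp
  have F0: "F n v = 0" if "- 1 * n \<le> 0" for n v using that by (simp add: F)
  have Fz: "F n 0 = 0" for n by (simp add: F)
  have act: "F (- 1 * int n) (emb q (\<Sum>\<iota>\<in>I. Sx (\<mu> \<iota> - int i) * ((fps_arg c ^ k) $ m * f \<iota>)))
      = emb q (\<Sum>\<iota>\<in>I. Sx (\<mu> \<iota> - int (i + n)) * (c n * ((fps_arg c ^ k) $ m * f \<iota>)))"
    if n: "n > 0" for n i k m
  proof -
    \<comment> \<open>The coefficients of powers of c are built from constants, so they keep
      functions of x + y inside that class.\<close>
    have u: "ufun ((fps_arg c ^ k) $ m * f \<iota>)" if "\<iota> \<in> I" for \<iota>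
      using f [OF that] by (intro ufun_mult ufun_fps_power) (simp_all add: fps_arg_def c_def)
    have "F (- 1 * int n) (emb q g) = emb q (mfps_const (b / of_nat n) *
        (mfps_deriv (X (n - 1)) g - mfps_deriv (Y (n - 1)) g))" for g
      using n by (simp add: F emb_diff [symmetric])
    moreover have "mfps_const (b / of_nat n) * (mfps_deriv (X (n - 1)) (\<Sum>\<iota>\<in>I. Sx (\<mu> \<iota> - int i) * ((fps_arg c ^ k) $ m * f \<iota>))
          - mfps_deriv (Y (n - 1)) (\<Sum>\<iota>\<in>I. Sx (\<mu> \<iota> - int i) * ((fps_arg c ^ k) $ m * f \<iota>)))
        = (\<Sum>\<iota>\<in>I. Sx (\<mu> \<iota> - int (i + n)) * (c n * ((fps_arg c ^ k) $ m * f \<iota>)))"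
      unfolding mfps_deriv_sum sum_subtractf [symmetric] sum_distrib_left
    proof (rule sum.cong)
      fix \<iota> assume \<iota>: "\<iota> \<in> I"
      define g where "g = (fps_arg c ^ k) $ m * f \<iota>"
      have g: "mfps_deriv (X (n - 1)) g = mfps_deriv (Y (n - 1)) g"
        using u [OF \<iota>] by (simp add: ufun_def g_def)
      have cn: "c n = - mfps_const (b / of_nat n)"
        by (simp add: c_def mfps_const_simps(5) [symmetric])
      have e: "\<mu> \<iota> - int i - int (Suc (n - 1)) = \<mu> \<iota> - int (i + n)" using n by simp
      \<comment> \<open>The two derivatives of g cancel, which leaves the derivative of
        \<open>Sx\<close> alone.\<close>
      have "mfps_deriv (X (n - 1)) (Sx (\<mu> \<iota> - int i) * g) - mfps_deriv (Y (n - 1)) (Sx (\<mu> \<iota> - int i) * g)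
          = - (Sx (\<mu> \<iota> - int (i + n)) * g)"
        by (simp only: mfps_deriv_mult deriv_Sx g e) simp
      then show "mfps_const (b / of_nat n) * (mfps_deriv (X (n - 1)) (Sx (\<mu> \<iota> - int i) * ((fps_arg c ^ k) $ m * f \<iota>))
          - mfps_deriv (Y (n - 1)) (Sx (\<mu> \<iota> - int i) * ((fps_arg c ^ k) $ m * f \<iota>)))
        = Sx (\<mu> \<iota> - int (i + n)) * (c n * ((fps_arg c ^ k) $ m * f \<iota>))"
        unfolding g_def [symmetric] cn by (simp add: mult.left_commute)
    qed simp
    ultimately show ?thesis by simp
  qed
  note * = ser_exp_action [where Z = "\<lambda>\<iota> i. Sx (\<mu> \<iota> - int i)" and f = f, OF eps F0 Fz act]
  show ?thesis
  proof (cases "k < 0")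
    case True
    then show ?thesis using *(2) [of "- k"] by simp
  next
    case False
    then obtain n where n: "k = int n" using zero_le_imp_eq_int by (metis linorder_not_le)
    show ?thesis
      using *(1) [of n] by (simp add: n c_def sum_distrib_left mult.left_commute)
  qed
qed

section \<open>The lowering exponentials as 1 - w and 1/(1 - w)\<close>

lemma of_nat_mult_const_divide:
  "l > 0 \<Longrightarrow> of_nat l * mfps_const (b / of_nat l) = (mfps_const b :: xyser)"
  by (simp add: mfps_const_of_nat [symmetric] mfps_const_simps(4) [symmetric])

text \<open>The exponent is the sum of w^n/n, that is -log(1 - w), so its exponential is the
  geometric series.\<close>

lemma schur_inverse_nat: "schur n (\<lambda>n. mfps_const (1 / of_nat n)) = (1 :: xyser)"
  by (rule schur_unique [symmetric, where g = "\<lambda>_. 1"])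
    (simp_all add: of_nat_mult_const_divide mfps_const_simps)

text \<open>Here the exponent is log(1 - w), so its exponential is 1 - w.\<close>

lemma schur_minus_inverse_nat:
  "schur n (\<lambda>n. mfps_const (- 1 / of_nat n)) = (if n = 0 then 1 else if n = 1 then - 1 else 0 :: xyser)"
proof (rule schur_unique [symmetric])
  fix n :: nat assume n: "n > 0"
  let ?g = "\<lambda>n::nat. if n = 0 then 1 else if n = 1 then - 1 else 0 :: xyser"
  \<comment> \<open>The partial sums of 1, -1, 0, 0, ... vanish after the first.\<close>
  have s: "sum ?g {..<n} = (if n = 1 then 1 else 0)" if "n > 0" for n
    using that by (induction n) (auto split: if_splits)
  have "(\<Sum>l = 1..n. of_nat l * mfps_const (- 1 / of_nat l) * ?g (n - l)) = (\<Sum>l = 1..n. - ?g (n - l))"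
    by (intro sum.cong) (auto simp: of_nat_mult_const_divide mfps_const_simps)
  also have "\<dots> = - sum ?g {..<n}"
    unfolding sum_negf
    by (intro arg_cong [where f = uminus] sum.reindex_bij_witness [where i = "\<lambda>j. n - j" and j = "\<lambda>l. n - l"]) auto
  finally show "of_nat n * ?g n = (\<Sum>l = 1..n. of_nat l * mfps_const (- 1 / of_nat l) * ?g (n - l))"
    unfolding s [OF n] using n by simp
qed simp

lemma ser_exp_eta:
  assumes "\<And>\<iota>. \<iota> \<in> I \<Longrightarrow> ufun (f \<iota>)"
  shows "ser_exp eta (- k) (emb q (\<Sum>\<iota>\<in>I. Sx (\<mu> \<iota>) * f \<iota>))
    = (if k = 0 then emb q (\<Sum>\<iota>\<in>I. Sx (\<mu> \<iota>) * f \<iota>)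
       else if k = 1 then - emb q (\<Sum>\<iota>\<in>I. Sx (\<mu> \<iota> - 1) * f \<iota>) else emb q 0)"
proof -
  have eta: "eta = (\<lambda>n. if n < 0
      then (\<lambda>v. scal (1 / of_int (- n)) (dx (nat (- n)) v - dy (nat (- n)) v)) else 0)"
    by (auto simp: eta_def)
  have "schurz (\<lambda>n. mfps_const (- 1 / of_nat n)) k
      = (if k = 0 then 1 else if k = 1 then - 1 else 0 :: xyser)"
    by (simp only: schurz_def schur_minus_inverse_nat) auto
  then show ?thesis
    using ser_exp_lowering [OF eta, where I = I and f = f and k = k and q = q and \<mu> = \<mu>] assms by (auto simp: emb_uminus)
qed

lemma ser_exp_minus_eta:
  assumes "\<And>\<iota>. \<iota> \<in> I \<Longrightarrow> ufun (f \<iota>)"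
  shows "ser_exp (- eta) (- k) (emb q (\<Sum>\<iota>\<in>I. Sx (\<mu> \<iota>) * f \<iota>))
    = (if k < 0 then emb q 0 else emb q (\<Sum>\<iota>\<in>I. Sx (\<mu> \<iota> - k) * f \<iota>))"
proof -
  have scal_minus: "- scal c v r = scal (- c) v r" for c v r
    by (simp add: scal_def fmul_def fun_eq_iff mfps_const_simps)
  have eta: "- eta = (\<lambda>n. if n < 0
      then (\<lambda>v. scal (- 1 / of_int (- n)) (dx (nat (- n)) v - dy (nat (- n)) v)) else 0)"
    by (intro ext) (simp only: eta_def uminus_apply, simp add: scal_minus)
  have "schurz (\<lambda>n. mfps_const (- (- 1) / of_nat n)) k = (if k < 0 then 0 else 1 :: xyser)"
    by (simp add: schurz_def schur_inverse_nat)
  then show ?thesis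
    using ser_exp_lowering [OF eta, where I = I and f = f and k = k and q = q and \<mu> = \<mu>] assms by auto
qed

text \<open>The lowering factor of \<phi> is 1 - w, where w stands for the inverse of z combined
  with the shift of \<open>Sx\<close>. Hence each mode has just two terms.\<close>

lemma phi_emb:
  assumes f: "\<And>\<iota>. \<iota> \<in> I \<Longrightarrow> ufun (f \<iota>)"
  shows "phi (- int j) (emb q (\<Sum>\<iota>\<in>I. Sx (\<mu> \<iota>) * f \<iota>))
    = emb (q - 1) (\<Sum>\<iota>\<in>I. (Su (int j - 1) * Sx (\<mu> \<iota>) - Su (int j) * Sx (\<mu> \<iota> - 1)) * f \<iota>)"
proof -
  let ?v = "emb q (\<Sum>\<iota>\<in>I. Sx (\<mu> \<iota>) * f \<iota>)"
  have eta: "ser_exp eta (int j - 1 - k) ?v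
    = (if k = int j - 1 then ?v
       else if k = int j then - emb q (\<Sum>\<iota>\<in>I. Sx (\<mu> \<iota> - 1) * f \<iota>) else emb q 0)" for k
  proof -
    have e: "int j - 1 - k = - (k - int j + 1)" by simp
    show ?thesis
      unfolding e by (subst ser_exp_eta [where I = I and f = f and \<mu> = \<mu>]) (auto simp: f)
  qed
  \<comment> \<open>The lowering factor has exponents 0 and -1 only, so the other factor enters with
    exponents \<open>int j - 1\<close> and \<open>int j\<close>.\<close>
  have "(ser_exp (- xi) \<star> ser_exp eta) (int j - 1) ?v
      = (\<Sum>a\<in>{0, 1::nat}. ser_exp (- xi) (int j - 1 + int a) (ser_exp eta (int j - 1 - (int j - 1 + int a)) ?v))"
    unfolding ser_mult_def
  proof (rule infsum_finite_support)
    fix k assume "k \<notin> (\<lambda>a. int j - 1 + int a) ` {0, 1}"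
    then have "k \<noteq> int j - 1" "k \<noteq> int j" by auto
    then show "ser_exp (- xi) k (ser_exp eta (int j - 1 - k) ?v) = 0"
      unfolding eta by (simp add: ser_exp_minus_xi del: emb_0) simp
  qed auto
  also have "\<dots> = emb q (\<Sum>\<iota>\<in>I. (Su (int j - 1) * Sx (\<mu> \<iota>) - Su (int j) * Sx (\<mu> \<iota> - 1)) * f \<iota>)"
    using eta [of "int j - 1"] eta [of "int j"]
    by (simp add: ser_exp_minus_xi emb_uminus [symmetric] emb_add [symmetric] emb_diff [symmetric]
        left_diff_distrib sum_subtractf sum_distrib_left mult.assoc)
  finally show ?thesis
    unfolding phi_def phi_series_def ser_const_mult by simp
qed

text \<open>A truncated convolution: of the coefficient of w^(m+l+1) in exp(-\<Sum>x_n w^n)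
  exp(\<Sum>(x_n+y_n) w^n), the part in which the index of \<open>Hu\<close> exceeds l.\<close>

definition KS :: "nat \<Rightarrow> nat \<Rightarrow> xyser" where
  "KS m l = (\<Sum>i\<le>m. Sx (int m - int i) * Hu (int i + int l + 1))"

lemma KS_extend: "m \<le> M \<Longrightarrow> KS m l = (\<Sum>i\<le>M. Sx (int m - int i) * Hu (int i + int l + 1))"
  unfolding KS_def by (intro sum.mono_neutral_left) auto

text \<open>Splitting off i = 0 relates neighbouring truncations; the cancellation of the
  \<open>Hu\<close> terms rests on this difference.\<close>

lemma KS_Suc: "KS (Suc m) l = Sx (int (Suc m)) * Hu (int l + 1) + KS m (Suc l)"
  unfolding KS_def by (subst sum.atMost_Suc_shift) (simp add: add_ac)

section \<open>The mode \<open>phi_star 0\<close> on vectors of p-degree 0, where p dp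
  vanishes\<close>

lemma current_emb:
  "current k (emb 0 f) = emb 0 (if k \<ge> 0 then of_int (k + 1) * xv (nat (k + 1)) * f
     else if k = - 1 then 0 else mfps_deriv (X (nat (- k - 2))) f)"
proof -
  have "nat (- k - 1) - 1 = nat (- k - 2)" by simp
  then show ?thesis by (simp add: current_def)
qed

text \<open>The Schur recursion for -x, with l = i - r + 1.\<close>

lemma sum_multiplication_part:
  assumes "m \<le> M"
  shows "(\<Sum>i\<in>{r..M}. of_nat (i - r + 1) * xv (i - r + 1) * Sx (int m - int i))
    = - (of_int (int m + 1 - int r) * Sx (int m + 1 - int r))"
proof -
  have "(\<Sum>i\<in>{r..M}. of_nat (i - r + 1) * xv (i - r + 1) * Sx (int m - int i))
      = (\<Sum>l\<in>{1..M + 1 - r}. of_nat l * xv l * Sx ((int m + 1 - int r) - int l))"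
    by (rule sum.reindex_bij_witness [where i = "\<lambda>l. l + r - 1" and j = "\<lambda>i. i - r + 1"])
      (auto simp: of_nat_diff algebra_simps)
  also have "\<dots> = - (\<Sum>l\<in>{1..M + 1 - r}. of_nat l * (- xv l) * Sx ((int m + 1 - int r) - int l))"
    by (simp add: sum_negf)
  also have "\<dots> = - (of_int (int m + 1 - int r) * Sx (int m + 1 - int r))"
    using assms by (subst schurz_rec) auto
  finally show ?thesis .
qed

text \<open>By the product rule. Differentiating \<open>Sx\<close> gives the same term for every i,
  since the shift by r - 1 - i turns m - i into m + 1 - r; it remains to count the indices.\<close>

lemma sum_derivative_part:
  assumes "m \<le> M"
  shows "(\<Sum>i | i \<le> M \<and> i + 2 \<le> r. mfps_deriv (X (r - 2 - i)) (Sx (int m - int i) * g))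
    = - (of_nat (r - 1) * Sx (int m + 1 - int r) * g)
      + (\<Sum>i | i \<le> M \<and> i + 2 \<le> r. Sx (int m - int i) * mfps_deriv (X (r - 2 - i)) g)"
proof -
  let ?A = "{i. i \<le> M \<and> i + 2 \<le> r}"
  have "(\<Sum>i\<in>?A. mfps_deriv (X (r - 2 - i)) (Sx (int m - int i) * g))
      = (\<Sum>i\<in>?A. - (Sx (int m + 1 - int r) * g) + Sx (int m - int i) * mfps_deriv (X (r - 2 - i)) g)"
  proof (rule sum.cong)
    fix i assume "i \<in> ?A"
    then have "int m - int i - int (Suc (r - 2 - i)) = int m + 1 - int r" by auto
    then show "mfps_deriv (X (r - 2 - i)) (Sx (int m - int i) * g)
        = - (Sx (int m + 1 - int r) * g) + Sx (int m - int i) * mfps_deriv (X (r - 2 - i)) g"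
      by (simp only: mfps_deriv_mult deriv_Sx) simp
  qed simp
  also have "\<dots> = - (of_nat (card ?A) * Sx (int m + 1 - int r) * g)
      + (\<Sum>i\<in>?A. Sx (int m - int i) * mfps_deriv (X (r - 2 - i)) g)"
    by (simp only: sum.distrib sum_constant mult_minus_right mult.assoc)
  also have "of_nat (card ?A) * Sx (int m + 1 - int r) = of_nat (r - 1) * Sx (int m + 1 - int r)"
  proof (cases "r \<le> M + 2")
    case True
    then have "?A = {..<r - 1}" by auto
    then show ?thesis by simp
  next
    \<comment> \<open>The count is then not r - 1, but both sides vanish because m + 1 - r is
      negative.\<close>
    case False
    then show ?thesis using assms by simp
  qed
  finally show ?thesis .
qed

text \<open>The coefficient of \<open>z\<^sup>-\<^sup>r\<close> of the current times the lowering exponential.\<close>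

definition inner_coeff :: "nat \<Rightarrow> (nat \<Rightarrow> xyser) \<Rightarrow> int \<Rightarrow> xyser" where
  "inner_coeff M f r = (\<Sum>i\<le>M. let k = int i - r; g = \<Sum>m\<le>M. Sx (int m - int i) * f m in
     if k \<ge> 0 then of_int (k + 1) * xv (nat (k + 1)) * g
     else if k = - 1 then 0 else mfps_deriv (X (nat (- k - 2))) g)"

text \<open>The lowering factor is a geometric series, so every shift i occurs with coefficient 1,
  and shifts beyond M give \<open>Sx\<close> of negative index.\<close>

lemma current_lowering_emb:
  assumes "\<And>m. m \<le> M \<Longrightarrow> ufun (f m)"
  shows "(current \<star> ser_exp (- eta)) (- r) (emb 0 (\<Sum>m\<le>M. Sx (int m) * f m))
    = emb 0 (inner_coeff M f r)"
proof -
  let ?v = "emb 0 (\<Sum>m\<le>M. Sx (int m) * f m)"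
  have ex: "ser_exp (- eta) (- k) ?v
      = (if k < 0 then emb 0 0 else emb 0 (\<Sum>m\<le>M. Sx (int m - k) * f m))" for k
    by (rule ser_exp_minus_eta) (use assms in auto)
  have "(current \<star> ser_exp (- eta)) (- r) ?v
      = (\<Sum>i\<in>{..M}. current (int i - r) (ser_exp (- eta) (- r - (int i - r)) ?v))"
    unfolding ser_mult_def
  proof (rule infsum_finite_support)
    fix k assume k: "k \<notin> (\<lambda>i. int i - r) ` {..M}"
    have e: "- r - k = - (k + r)" by simp
    have "k + r < 0 \<or> k + r > int M"
    proof (rule ccontr)
      assume "\<not> (k + r < 0 \<or> k + r > int M)"
      then have "k = int (nat (k + r)) - r" "nat (k + r) \<in> {..M}" by auto
      with k show False by blast
    qed
    then have "ser_exp (- eta) (- r - k) ?v = emb 0 0"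
      unfolding e ex by (auto intro!: arg_cong [where f = "emb 0"] sum.neutral)
    then show "current k (ser_exp (- eta) (- r - k) ?v) = 0"
      by (simp add: current_emb del: emb_0) simp
  qed (auto simp: inj_on_def)
  also have "\<dots> = (\<Sum>i\<in>{..M}. current (int i - r) (emb 0 (\<Sum>m\<le>M. Sx (int m - int i) * f m)))"
  proof (rule sum.cong)
    fix i
    have "- r - (int i - r) = - int i" by simp
    then show "current (int i - r) (ser_exp (- eta) (- r - (int i - r)) ?v)
        = current (int i - r) (emb 0 (\<Sum>m\<le>M. Sx (int m - int i) * f m))"
      by (simp only: ex) simp
  qed simp
  finally show ?thesis
    by (simp only: current_emb inner_coeff_def emb_sum [symmetric] Let_def)
qed

text \<open>For each m the range of i splits by the kind of current: multiplication by a variable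
  for i at least r, the vanishing p dp at i = r - 1, and derivatives below.\<close>

lemma inner_coeff_eq:
  "inner_coeff M f (int r) = (\<Sum>m\<le>M. - (of_int (int m + 1 - int r) * Sx (int m + 1 - int r) * f m)
      - of_nat (r - 1) * Sx (int m + 1 - int r) * f m
      + (\<Sum>i | i \<le> M \<and> i + 2 \<le> r. Sx (int m - int i) * mfps_deriv (X (r - 2 - i)) (f m)))"
proof -
  define c where "c m i = (let k = int i - int r; g = Sx (int m - int i) * f m in
     if k \<ge> 0 then of_int (k + 1) * xv (nat (k + 1)) * g
     else if k = - 1 then 0 else mfps_deriv (X (nat (- k - 2))) g)" for m i
  have "inner_coeff M f (int r) = (\<Sum>i\<le>M. \<Sum>m\<le>M. c m i)"
    unfolding inner_coeff_def c_def Let_def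
    by (intro sum.cong refl) (simp add: sum_distrib_left mfps_deriv_sum)
  also have "\<dots> = (\<Sum>m\<le>M. \<Sum>i\<le>M. c m i)" by (rule sum.swap)
  also have "\<dots> = (\<Sum>m\<le>M. - (of_int (int m + 1 - int r) * Sx (int m + 1 - int r) * f m)
      - of_nat (r - 1) * Sx (int m + 1 - int r) * f m
      + (\<Sum>i | i \<le> M \<and> i + 2 \<le> r. Sx (int m - int i) * mfps_deriv (X (r - 2 - i)) (f m)))"
  proof (rule sum.cong)
    fix m assume "m \<in> {..M}"
    then have m: "m \<le> M" by simp
    have split: "{..M} = {r..M} \<union> ({i. i \<le> M \<and> i + 1 = r} \<union> {i. i \<le> M \<and> i + 2 \<le> r})"
      by auto
    have "(\<Sum>i\<le>M. c m i) = (\<Sum>i\<in>{r..M}. c m i)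
        + ((\<Sum>i\<in>{i. i \<le> M \<and> i + 1 = r}. c m i) + (\<Sum>i | i \<le> M \<and> i + 2 \<le> r. c m i))"
      unfolding split by (subst sum.union_disjoint; (subst sum.union_disjoint)?) auto
    also have "(\<Sum>i\<in>{i. i \<le> M \<and> i + 1 = r}. c m i) = 0"
      by (intro sum.neutral) (auto simp: c_def)
    also have "(\<Sum>i\<in>{r..M}. c m i)
        = (\<Sum>i\<in>{r..M}. of_nat (i - r + 1) * xv (i - r + 1) * Sx (int m - int i)) * f m"
      unfolding sum_distrib_right
    proof (rule sum.cong)
      fix i assume "i \<in> {r..M}"
      then have k: "int i - int r = int (i - r)" by (simp add: of_nat_diff)
      have n: "nat (int (i - r) + 1) = i - r + 1" by simp
      have o: "of_int (int (i - r) + 1) = (of_nat (i - r + 1) :: xyser)" by simp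
      show "c m i = of_nat (i - r + 1) * xv (i - r + 1) * Sx (int m - int i) * f m"
        unfolding c_def Let_def k n o by (simp only: of_nat_0_le_iff if_True mult.assoc)
    qed simp
    also have "(\<Sum>i | i \<le> M \<and> i + 2 \<le> r. c m i)
        = (\<Sum>i | i \<le> M \<and> i + 2 \<le> r. mfps_deriv (X (r - 2 - i)) (Sx (int m - int i) * f m))"
    proof (rule sum.cong)
      fix i assume i: "i \<in> {i. i \<le> M \<and> i + 2 \<le> r}"
      then have "nat (- (int i - int r) - 2) = r - 2 - i" "\<not> int i - int r \<ge> 0" "int i - int r \<noteq> - 1"
        by auto
      then show "c m i = mfps_deriv (X (r - 2 - i)) (Sx (int m - int i) * f m)"
        unfolding c_def Let_def by (simp only: if_False)
    qed simp
    finally show "(\<Sum>i\<le>M. c m i) = - (of_int (int m + 1 - int r) * Sx (int m + 1 - int r) * f m)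
      - of_nat (r - 1) * Sx (int m + 1 - int r) * f m
      + (\<Sum>i | i \<le> M \<and> i + 2 \<le> r. Sx (int m - int i) * mfps_deriv (X (r - 2 - i)) (f m))"
      unfolding sum_multiplication_part [OF m] sum_derivative_part [OF m] by simp
  qed simp
  finally show ?thesis .
qed

text \<open>Pair the coefficient of z^(-r) with \<open>Hu r\<close>. For positive r the numerical
  factors -(m + 1 - r) and -(r - 1) add up to -m, independently of r, so these terms form
  \<open>KS m 0\<close>; the derivatives of \<open>f m\<close>, grouped by variable, form
  \<open>KS m (Suc l)\<close>.\<close>

lemma phi_star_emb:
  assumes u: "\<And>m. m \<le> M \<Longrightarrow> ufun (f m)"
    and L: "\<And>m i. m \<le> M \<Longrightarrow> i \<ge> L \<Longrightarrow> mfps_deriv (X i) (f m) = 0"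
  shows "phi_star 0 (emb 0 (\<Sum>m\<le>M. Sx (int m) * f m))
    = emb 1 (\<Sum>m\<le>M. - (of_nat (Suc m) * Sx (int (Suc m)) * f m) - of_nat m * KS m 0 * f m
        + (\<Sum>l<L. mfps_deriv (X l) (f m) * KS m (Suc l)))"
proof -
  \<comment> \<open>Beyond \<open>?R\<close> the index m + 1 - r is negative and r - 2 - i is at
    least L for every i up to M, so nothing survives.\<close>
  let ?v = "emb 0 (\<Sum>m\<le>M. Sx (int m) * f m)" and ?R = "M + L + 1"
  have low: "(current \<star> ser_exp (- eta)) (- r) ?v = emb 0 (inner_coeff M f r)" for r
    by (rule current_lowering_emb) (rule u)
  define c where "c m r = - (of_int (int m + 1 - int r) * Sx (int m + 1 - int r) * f m)
      - of_nat (r - 1) * Sx (int m + 1 - int r) * f m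
      + (\<Sum>i | i \<le> M \<and> i + 2 \<le> r. Sx (int m - int i) * mfps_deriv (X (r - 2 - i)) (f m))" for m r
  have inner: "inner_coeff M f (int r) = (\<Sum>m\<le>M. c m r)" for r
    by (simp only: inner_coeff_eq c_def)
  have c_large: "c m r = 0" if "m \<le> M" "r > ?R" for m r
  proof -
    have "Sx (int m - int i) * mfps_deriv (X (r - 2 - i)) (f m) = 0" if "i \<le> M" for i
      using \<open>r > ?R\<close> that \<open>m \<le> M\<close> by (subst L) auto
    moreover have "int m + 1 - int r < 0" using that by simp
    ultimately show ?thesis by (simp add: c_def sum.neutral)
  qed
  have "(ser_exp xi \<star> current \<star> ser_exp (- eta)) 0 ?v
      = (\<Sum>r\<in>{..?R}. ser_exp xi (int r) ((current \<star> ser_exp (- eta)) (0 - int r) ?v))"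
    unfolding ser_mult_def [of "ser_exp xi"]
  proof (rule infsum_finite_support)
    fix k assume k: "k \<notin> int ` {..?R}"
    have e: "0 - k = - k" by simp
    have "Hu k * inner_coeff M f k = 0"
    proof (cases "k < 0")
      case False
      then obtain r where r: "k = int r" using zero_le_imp_eq_int by (metis linorder_not_le)
      with k have "r > ?R" by (metis atMost_iff imageI linorder_not_le)
      then have "inner_coeff M f k = 0"
        unfolding r inner by (intro sum.neutral) (simp add: c_large)
      then show ?thesis by simp
    qed simp
    then show "ser_exp xi k ((current \<star> ser_exp (- eta)) (0 - k) ?v) = 0"
      by (simp only: e low ser_exp_xi emb_0)
  qed simp_all
  also have "\<dots> = emb 0 (\<Sum>r\<le>?R. Hu (int r) * (\<Sum>m\<le>M. c m r))"
    by (simp only: diff_0 low ser_exp_xi inner emb_sum [of 0 "\<lambda>r. Hu (int r) * (\<Sum>m\<le>M. c m r)"])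
  also have "(\<Sum>r\<le>?R. Hu (int r) * (\<Sum>m\<le>M. c m r)) = (\<Sum>m\<le>M. \<Sum>r\<le>?R. Hu (int r) * c m r)"
    unfolding sum_distrib_left by (rule sum.swap)
  also have "\<dots> = (\<Sum>m\<le>M. - (of_nat (Suc m) * Sx (int (Suc m)) * f m) - of_nat m * KS m 0 * f m
        + (\<Sum>l<L. mfps_deriv (X l) (f m) * KS m (Suc l)))"
  proof (rule sum.cong)
    fix m assume "m \<in> {..M}"
    then have m: "m \<le> M" by simp
    \<comment> \<open>At r = 0 the truncated difference \<open>r - 1\<close> is 0 and there is no
      derivative term.\<close>
    have c0: "c m 0 = - (of_nat (Suc m) * Sx (int (Suc m)) * f m)"
      by (simp add: c_def add.commute)
    define d where "d r = (\<Sum>i | i \<le> M \<and> i + 2 \<le> r. Sx (int m - int i) * mfps_deriv (X (r - 2 - i)) (f m))" for r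
    have cSuc: "c m (Suc r) = - (of_nat m * Sx (int m - int r) * f m) + d (Suc r)" for r
    proof -
      have "(of_int (int m + 1 - int (Suc r)) :: xyser) = of_nat m - of_nat r" by simp
      then show ?thesis
        unfolding c_def d_def by (simp add: algebra_simps)
    qed
    have "(\<Sum>r\<le>?R. Hu (int r) * c m r) = c m 0 + (\<Sum>r\<le>M + L. Hu (int (Suc r)) * c m (Suc r))"
      unfolding Suc_eq_plus1 [symmetric] by (subst sum.atMost_Suc_shift) simp
    also have "(\<Sum>r\<le>M + L. Hu (int (Suc r)) * c m (Suc r))
        = - (of_nat m * (\<Sum>r\<le>M + L. Sx (int m - int r) * Hu (int r + int 0 + 1)) * f m)
          + (\<Sum>r\<le>M + L. Hu (int (Suc r)) * d (Suc r))"
      unfolding cSuc distrib_left sum.distrib sum_distrib_left sum_distrib_right mult_minus_right sum_negf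
      by (simp add: ac_simps)
    also have "(\<Sum>r\<le>M + L. Sx (int m - int r) * Hu (int r + int 0 + 1)) = KS m 0"
      using m by (intro KS_extend [symmetric]) auto
    also have "(\<Sum>r\<le>M + L. Hu (int (Suc r)) * d (Suc r))
        = (\<Sum>(r, i)\<in>Sigma {..M + L} (\<lambda>r. {i. i \<le> M \<and> i + 2 \<le> Suc r}).
            Hu (int (Suc r)) * (Sx (int m - int i) * mfps_deriv (X (Suc r - 2 - i)) (f m)))"
      by (simp add: d_def sum_distrib_left sum.Sigma)
    \<comment> \<open>Group by the differentiated variable \<open>X l\<close> with l = r - 1 - i;
      the pairs with l at least L vanish by \<open>L\<close>.\<close>
    also have "\<dots> = (\<Sum>(l, i)\<in>{..<L} \<times> {..M}.
        mfps_deriv (X l) (f m) * (Sx (int m - int i) * Hu (int i + int (Suc l) + 1)))"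
    proof (rule sum.reindex_bij_witness_not_neutral [where S' = "{(r, i). r \<ge> L + i + 1} \<inter> Sigma {..M + L} (\<lambda>r. {i. i \<le> M \<and> i + 2 \<le> Suc r})" and T' = "{}"
          and i = "\<lambda>(l, i). (l + i + 1, i)" and j = "\<lambda>(r, i). (r - 1 - i, i)"], goal_cases)
      case (7 p)
      then show ?case using m by (auto simp: L)
    next
      case (9 p)
      obtain r i where p: "p = (r, i)" by force
      from 9 have r: "i + 1 \<le> r" by (auto simp: p)
      have "Suc r - 2 - i = r - 1 - i" "int (Suc r) = int i + int (Suc (r - 1 - i)) + 1"
        using r by auto
      then show ?case by (simp only: p prod.case mult.assoc mult.commute mult.left_commute)
    qed auto
    also have "\<dots> = (\<Sum>l<L. mfps_deriv (X l) (f m) * KS m (Suc l))"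
      by (simp add: sum.cartesian_product [symmetric] sum_distrib_left KS_extend [OF m])
    finally show "(\<Sum>r\<le>?R. Hu (int r) * c m r) = - (of_nat (Suc m) * Sx (int (Suc m)) * f m) - of_nat m * KS m 0 * f m
        + (\<Sum>l<L. mfps_deriv (X l) (f m) * KS m (Suc l))"
      unfolding c0 by simp
  qed simp
  finally have prod: "(ser_exp xi \<star> current \<star> ser_exp (- eta)) 0 ?v
      = emb 0 (\<Sum>m\<le>M. - (of_nat (Suc m) * Sx (int (Suc m)) * f m) - of_nat m * KS m 0 * f m
        + (\<Sum>l<L. mfps_deriv (X l) (f m) * KS m (Suc l)))" .
  show ?thesis
    by (simp only: phi_star_def phi_star_series_def minus_zero ser_const_mult prod p_power_emb add_0)
qed

subsection \<open>The powers of the operator on the vacuum\<close>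

definition usig :: "(nat \<Rightarrow> complex) \<Rightarrow> nat \<Rightarrow> xyser" where
  "usig a s = (\<Sum>j=1..s. mfps_const (a j) * Su (int j))"

text \<open>The derivative of \<sigma> by \<open>X l\<close>, that is by x_(l+1);
  \<open>udel a s 0\<close> is \<delta>.\<close>

definition udel :: "(nat \<Rightarrow> complex) \<Rightarrow> nat \<Rightarrow> nat \<Rightarrow> xyser" where
  "udel a s l = - (\<Sum>j=1..s. mfps_const (a j) * Su (int j - int (Suc l)))"

lemma deriv_usig [simp]: "mfps_deriv (X l) (usig a s) = udel a s l"
  by (simp add: usig_def udel_def mfps_deriv_sum sum_negf del: schurz_of_nat)

lemma deriv_udel [simp]: "mfps_deriv (X l) (udel a s i) = - udel a s (Suc (i + l))"
  by (simp add: udel_def mfps_deriv_sum sum_negf algebra_simps)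

lemma ufun_usig [simp]: "ufun (usig a s)" and ufun_udel [simp]: "ufun (udel a s l)"
  by (simp_all add: usig_def udel_def del: schurz_of_nat)

lemma udel_eq_0 [simp]: "l \<ge> s \<Longrightarrow> udel a s l = 0"
  by (auto simp: udel_def intro!: sum.neutral)

text \<open>The coefficient of w^j in exp(-T) exp(T) = 1, with the term of \<open>Hu 0\<close> moved
  to the right; terms beyond j have negative index.\<close>

lemma Su_Hu_convolution:
  assumes "1 \<le> j" "j \<le> s"
  shows "(\<Sum>l<s. Su (int j - int (Suc l)) * Hu (int l + 1)) = - Su (int j)"
proof -
  have "(\<Sum>l=0..j. Hu (int l) * Su (int (j - l))) = 0"
    using schur_uminus_convolution [of j "\<lambda>n. xv n + yv n"] assms by (simp del: of_nat_diff)
  then have "0 = (\<Sum>l\<le>j. Su (int (j - l)) * Hu (int l))"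
    by (simp add: atLeast0AtMost mult.commute)
  also have "\<dots> = Su (int j) + (\<Sum>l<j. Su (int (j - Suc l)) * Hu (int (Suc l)))"
    by (subst sum.atMost_shift) simp
  also have "(\<Sum>l<j. Su (int (j - Suc l)) * Hu (int (Suc l)))
      = (\<Sum>l<s. Su (int j - int (Suc l)) * Hu (int l + 1))"
    using assms by (intro sum.mono_neutral_cong_left) (auto simp: of_nat_diff algebra_simps)
  finally show ?thesis by (simp add: eq_neg_iff_add_eq_0 add.commute)
qed

text \<open>The convolution above, applied to each j; it is what turns the \<open>Hu\<close> terms
  back into \<sigma>.\<close>

lemma sum_udel_Hu: "(\<Sum>l<s. udel a s l * Hu (int l + 1)) = usig a s"
proof -
  have "(\<Sum>l<s. udel a s l * Hu (int l + 1))
      = - (\<Sum>j=1..s. mfps_const (a j) * (\<Sum>l<s. Su (int j - int (Suc l)) * Hu (int l + 1)))"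
    unfolding udel_def mult_minus_left sum_negf sum_distrib_left sum_distrib_right
    by (subst sum.swap) (simp only: mult.assoc)
  also have "\<dots> = usig a s"
    unfolding usig_def sum_negf [symmetric]
    by (intro sum.cong refl) (simp del: schurz_of_nat of_nat_Suc add: Su_Hu_convolution)
  finally show ?thesis .
qed

text \<open>The coefficient of t^m in (\<sigma> + t \<delta>)^k. Replacing t^m by S_m(-x) in this
  power yields \<open>evec\<close>.\<close>

definition ecoef :: "(nat \<Rightarrow> complex) \<Rightarrow> nat \<Rightarrow> nat \<Rightarrow> nat \<Rightarrow> xyser" where
  "ecoef a s k m = of_nat (k choose m) * udel a s 0 ^ m * usig a s ^ (k - m)"

definition evec :: "(nat \<Rightarrow> complex) \<Rightarrow> nat \<Rightarrow> nat \<Rightarrow> xyser" where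
  "evec a s k = (\<Sum>m\<le>k. Sx (int m) * ecoef a s k m)"

lemma ufun_ecoef [simp]: "ufun (ecoef a s k m)"
  by (simp add: ecoef_def)

text \<open>The chain rule for (\<sigma> + t \<delta>)^k: the derivative of \<delta> is
  \<open>- udel a s (Suc l)\<close> and comes with a factor t, hence is absent at m = 0.\<close>

lemma deriv_ecoef:
  assumes "m \<le> k"
  shows "mfps_deriv (X l) (ecoef a s k m)
    = (if m = 0 then 0 else - (of_nat k * ecoef a s (k - 1) (m - 1) * udel a s (Suc l)))
      + of_nat k * ecoef a s (k - 1) m * udel a s l"
proof -
  have A: "(of_nat (k choose m) :: xyser) * of_nat m = of_nat k * of_nat (k - 1 choose (m - 1))" if "m > 0"
    using binomial_absorption [of "m - 1" k] that by (simp flip: of_nat_mult add: mult.commute)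
  have B: "(of_nat (k choose m) :: xyser) * of_nat (k - m) = of_nat k * of_nat (k - 1 choose m)"
    using binomial_absorb_comp [of k m] by (simp flip: of_nat_mult add: mult.commute)
  have e: "k - m = k - 1 - (m - 1)" "k - m - 1 = k - 1 - m" if "m > 0" using assms that by auto
  have "mfps_deriv (X l) (ecoef a s k m)
    = - ((of_nat (k choose m) * of_nat m) * udel a s 0 ^ (m - 1) * usig a s ^ (k - m) * udel a s (Suc l))
      + (of_nat (k choose m) * of_nat (k - m)) * udel a s 0 ^ m * usig a s ^ (k - m - 1) * udel a s l"
    by (simp add: ecoef_def mfps_deriv_power algebra_simps)
  note * = this [unfolded B]
  show ?thesis
  proof (cases "m = 0")
    case True
    then show ?thesis unfolding * by (simp add: ecoef_def mult.assoc)
  next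
    case False
    then have m: "m > 0" by simp
    show ?thesis
      unfolding * unfolding ecoef_def A [OF m] e(2) [OF m] if_not_P [OF False]
      unfolding e(1) [OF m] by (simp only: mult.assoc)
  qed
qed

text \<open>Coefficients of the t-derivative of (\<sigma> + t \<delta>)^k and of \<sigma> times its
  \<sigma>-derivative; in both cases binomial absorption.\<close>

lemma mult_ecoef:
  assumes "m \<le> k"
  shows "of_nat (Suc m) * ecoef a s k (Suc m) = of_nat k * ecoef a s (k - 1) m * udel a s 0"
    and "of_nat (k - m) * ecoef a s k m = of_nat k * ecoef a s (k - 1) m * usig a s"
proof -
  have A: "of_nat (Suc m) * (of_nat (k choose Suc m) :: xyser) = of_nat k * of_nat (k - 1 choose m)"
    using binomial_absorption [of m k] by (simp del: of_nat_Suc flip: of_nat_mult)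
  have "of_nat (Suc m) * ecoef a s k (Suc m)
      = (of_nat (Suc m) * of_nat (k choose Suc m)) * udel a s 0 ^ Suc m * usig a s ^ (k - Suc m)"
    unfolding ecoef_def by (simp only: mult.assoc)
  then show "of_nat (Suc m) * ecoef a s k (Suc m) = of_nat k * ecoef a s (k - 1) m * udel a s 0"
    unfolding A ecoef_def by (simp add: ac_simps)
  have B: "of_nat (k - m) * (of_nat (k choose m) :: xyser) = of_nat k * of_nat (k - 1 choose m)"
    using binomial_absorb_comp [of k m] by (simp flip: of_nat_mult)
  have "of_nat (k - m) * ecoef a s k m
      = (of_nat (k - m) * of_nat (k choose m)) * udel a s 0 ^ m * usig a s ^ (k - m)"
    unfolding ecoef_def by (simp only: mult.assoc)
  moreover have "usig a s ^ (k - m) = usig a s * usig a s ^ (k - 1 - m)" if "m \<noteq> k"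
    using assms that by (metis Suc_diff_Suc diff_Suc_1 diff_commute le_neq_implies_less power_Suc)
  \<comment> \<open>For m = k no factor \<sigma> can be split off, but then both sides are
    0.\<close>
  moreover have "k = 0 \<or> k - 1 choose m = 0" if "m = k"
    using that by (cases k) auto
  ultimately show "of_nat (k - m) * ecoef a s k m = of_nat k * ecoef a s (k - 1) m * usig a s"
    unfolding B ecoef_def by (cases "m = k") (auto simp: ac_simps)
qed

lemma ecoef_eq_0: "m > k \<Longrightarrow> ecoef a s k m = 0"
  by (simp add: ecoef_def binomial_eq_0)

text \<open>With c m = k times \<open>ecoef a s (k - 1) m\<close>, the contributions at m + 1 and at
  m that carry c m combine into differences \<open>KS (Suc m) l - KS m (Suc l)\<close>. Each equals
  \<open>Sx (Suc m)\<close> times \<open>Hu (l + 1)\<close>, and summation over l against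
  \<open>udel\<close> gives \<sigma>.\<close>

lemma deriv_terms_sum:
  "(\<Sum>m\<le>k. (\<Sum>l<s. mfps_deriv (X l) (ecoef a s k m) * KS m (Suc l)) - of_nat m * KS m 0 * ecoef a s k m)
    = - (\<Sum>m\<le>k. of_nat (k - m) * Sx (int (Suc m)) * ecoef a s k m)"
proof -
  define c where "c m = of_nat k * ecoef a s (k - 1) m" for m
  have ck: "c k = 0" by (cases k) (auto simp: c_def ecoef_eq_0)
  define F where "F m = - (\<Sum>l<s. c (m - 1) * udel a s (Suc l) * KS m (Suc l))
      - c (m - 1) * udel a s 0 * KS m 0" for m
  define G where "G m = c m * (\<Sum>l<s. udel a s l * KS m (Suc l))" for m
  have "(\<Sum>l<s. mfps_deriv (X l) (ecoef a s k m) * KS m (Suc l)) - of_nat m * KS m 0 * ecoef a s k m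
      = (if m = 0 then 0 else F m) + G m" if "m \<le> k" for m
  proof -
    have "of_nat m * KS m 0 * ecoef a s k m = (if m = 0 then 0 else c (m - 1) * udel a s 0 * KS m 0)"
    proof (cases m)
      case (Suc n)
      then have "of_nat m * KS m 0 * ecoef a s k m = KS m 0 * (of_nat (Suc n) * ecoef a s k (Suc n))"
        by (simp only: ac_simps)
      also have "\<dots> = c (m - 1) * udel a s 0 * KS m 0"
        using Suc that by (subst mult_ecoef(1)) (auto simp: c_def ac_simps)
      finally show ?thesis using Suc by simp
    qed simp
    moreover have "(\<Sum>l<s. mfps_deriv (X l) (ecoef a s k m) * KS m (Suc l))
        = (if m = 0 then 0 else - (\<Sum>l<s. c (m - 1) * udel a s (Suc l) * KS m (Suc l))) + G m"
      unfolding deriv_ecoef [OF that] G_def c_def [symmetric]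
      by (simp add: distrib_right sum.distrib sum_distrib_left sum_negf mult.assoc)
    ultimately show ?thesis by (simp add: F_def)
  qed
  then have "(\<Sum>m\<le>k. (\<Sum>l<s. mfps_deriv (X l) (ecoef a s k m) * KS m (Suc l)) - of_nat m * KS m 0 * ecoef a s k m)
      = (\<Sum>m\<le>k. (if m = 0 then 0 else F m)) + (\<Sum>m\<le>k. G m)"
    by (simp add: sum.distrib)
  also have "(\<Sum>m\<le>k. (if m = 0 then 0 else F m)) = (\<Sum>m<k. F (Suc m))"
    by (subst sum.atMost_shift) simp
  also have "(\<Sum>m\<le>k. G m) = (\<Sum>m<k. G m)"
    by (simp add: lessThan_Suc_atMost [symmetric] G_def ck)
  also have "(\<Sum>m<k. F (Suc m)) + (\<Sum>m<k. G m)
      = (\<Sum>m<k. - (c m * usig a s * Sx (int (Suc m))))"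
    unfolding sum.distrib [symmetric]
  proof (rule sum.cong)
    fix m
    have "(\<Sum>l<s. udel a s l * KS (Suc m) l)
        = udel a s 0 * KS (Suc m) 0 + (\<Sum>l<s. udel a s (Suc l) * KS (Suc m) (Suc l))"
    proof -
      \<comment> \<open>Since \<open>udel a s s\<close> is 0, the range can be lengthened by one
        before l = 0 is split off.\<close>
      have "(\<Sum>l<s. udel a s l * KS (Suc m) l) = (\<Sum>l<Suc s. udel a s l * KS (Suc m) l)"
        by simp
      then show ?thesis by (simp only: sum.lessThan_Suc_shift)
    qed
    then have "F (Suc m) + G m
        = - (c m * (\<Sum>l<s. udel a s l * (KS (Suc m) l - KS m (Suc l))))"
      by (simp add: F_def G_def sum_distrib_left sum_subtractf algebra_simps)
    also have "(\<Sum>l<s. udel a s l * (KS (Suc m) l - KS m (Suc l)))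
        = (\<Sum>l<s. udel a s l * Hu (int l + 1)) * Sx (int (Suc m))"
      unfolding sum_distrib_right by (rule sum.cong) (simp_all add: KS_Suc ac_simps)
    finally show "F (Suc m) + G m = - (c m * usig a s * Sx (int (Suc m)))"
      by (simp only: sum_udel_Hu mult.assoc)
  qed simp
  also have "\<dots> = - (\<Sum>m\<le>k. of_nat (k - m) * Sx (int (Suc m)) * ecoef a s k m)"
  proof -
    have "of_nat (k - m) * Sx (int (Suc m)) * ecoef a s k m = c m * usig a s * Sx (int (Suc m))"
      if "m \<le> k" for m
    proof -
      have "of_nat (k - m) * Sx (int (Suc m)) * ecoef a s k m
          = (of_nat (k - m) * ecoef a s k m) * Sx (int (Suc m))" by (simp only: ac_simps)
      then show ?thesis by (simp only: mult_ecoef(2) [OF that] c_def)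
    qed
    then show ?thesis
      by (simp add: lessThan_Suc_atMost [symmetric] ck sum_negf)
  qed
  finally show ?thesis .
qed

text \<open>The explicit terms contribute -(m + 1) and the derivative terms -(k - m); their sum -(k
  + 1) is the same for all m, while every S_m(-x) is raised to S_(m+1)(-x).\<close>

lemma phi_star_evec:
  "phi_star 0 (emb 0 (mfps_const c * evec a s k))
    = emb 1 (\<Sum>m\<le>k. Sx (int (Suc m)) * (- (of_nat (Suc k) * mfps_const c) * ecoef a s k m))"
proof -
  let ?g = "ecoef a s k" and ?b = "mfps_const c :: xyser"
  have "mfps_const c * evec a s k = (\<Sum>m\<le>k. Sx (int m) * (?b * ?g m))"
    by (simp add: evec_def sum_distrib_left mult.left_commute)
  moreover have "phi_star 0 (emb 0 (\<Sum>m\<le>k. Sx (int m) * (?b * ?g m)))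
    = emb 1 (\<Sum>m\<le>k. - (of_nat (Suc m) * Sx (int (Suc m)) * (?b * ?g m)) - of_nat m * KS m 0 * (?b * ?g m)
        + (\<Sum>l<s. mfps_deriv (X l) (?b * ?g m) * KS m (Suc l)))"
    by (rule phi_star_emb) (simp_all add: deriv_ecoef)
  moreover have "(\<Sum>m\<le>k. - (of_nat (Suc m) * Sx (int (Suc m)) * (?b * ?g m)) - of_nat m * KS m 0 * (?b * ?g m)
        + (\<Sum>l<s. mfps_deriv (X l) (?b * ?g m) * KS m (Suc l)))
     = ?b * ((\<Sum>m\<le>k. - (of_nat (Suc m) * Sx (int (Suc m)) * ?g m))
        + (\<Sum>m\<le>k. (\<Sum>l<s. mfps_deriv (X l) (?g m) * KS m (Suc l)) - of_nat m * KS m 0 * ?g m))"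
    unfolding sum.distrib [symmetric] sum_distrib_left
  proof (rule sum.cong)
    fix m
    have "(\<Sum>l<s. mfps_deriv (X l) (?b * ?g m) * KS m (Suc l))
        = ?b * (\<Sum>l<s. mfps_deriv (X l) (?g m) * KS m (Suc l))"
      by (simp add: sum_distrib_left mult.assoc)
    then show "- (of_nat (Suc m) * Sx (int (Suc m)) * (?b * ?g m)) - of_nat m * KS m 0 * (?b * ?g m)
        + (\<Sum>l<s. mfps_deriv (X l) (?b * ?g m) * KS m (Suc l))
      = ?b * (- (of_nat (Suc m) * Sx (int (Suc m)) * ?g m)
        + ((\<Sum>l<s. mfps_deriv (X l) (?g m) * KS m (Suc l)) - of_nat m * KS m 0 * ?g m))"
      by (simp only: distrib_left right_diff_distrib mult_minus_right ac_simps) (simp add: algebra_simps)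
  qed simp
  moreover have "?b * ((\<Sum>m\<le>k. - (of_nat (Suc m) * Sx (int (Suc m)) * ?g m))
        - (\<Sum>m\<le>k. of_nat (k - m) * Sx (int (Suc m)) * ?g m))
      = (\<Sum>m\<le>k. Sx (int (Suc m)) * (- (of_nat (Suc k) * ?b) * ?g m))"
    unfolding sum_subtractf [symmetric] sum_distrib_left
  proof (rule sum.cong)
    fix m assume "m \<in> {..k}"
    then have "(of_nat (Suc k) :: xyser) = of_nat (Suc m) + of_nat (k - m)"
      by (simp flip: of_nat_add)
    then show "?b * (- (of_nat (Suc m) * Sx (int (Suc m)) * ?g m) - of_nat (k - m) * Sx (int (Suc m)) * ?g m)
        = Sx (int (Suc m)) * (- (of_nat (Suc k) * ?b) * ?g m)"
      by (simp only:) (simp add: algebra_simps)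
  qed simp
  ultimately show ?thesis by (simp only: deriv_terms_sum add_uminus_conv_diff)
qed

lemma ecoef_Suc_Suc:
  assumes "m \<le> k"
  shows "ecoef a s (Suc k) (Suc m) = udel a s 0 * ecoef a s k m + usig a s * ecoef a s k (Suc m)"
proof (cases "m = k")
  case False
  with assms have "k - m = Suc (k - Suc m)" by simp
  then show ?thesis by (simp add: ecoef_def algebra_simps)
qed (simp add: ecoef_def binomial_eq_0)

text \<open>One more factor \<sigma> + t \<delta>, where t acts by raising the index of
  \<open>Sx\<close>; the coefficients match by Pascal's rule.\<close>

lemma evec_Suc:
  "evec a s (Suc k) = (\<Sum>m\<le>k. (udel a s 0 * Sx (int (Suc m)) + usig a s * Sx (int m)) * ecoef a s k m)"
proof -
  let ?d = "udel a s 0" and ?\<sigma> = "usig a s" and ?g = "ecoef a s k"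
  have "evec a s (Suc k) = Sx 0 * ecoef a s (Suc k) 0
      + (\<Sum>m\<le>k. Sx (int (Suc m)) * ecoef a s (Suc k) (Suc m))"
    unfolding evec_def by (subst sum.atMost_Suc_shift) simp
  also have "(\<Sum>m\<le>k. Sx (int (Suc m)) * ecoef a s (Suc k) (Suc m))
      = (\<Sum>m\<le>k. ?d * Sx (int (Suc m)) * ?g m) + (\<Sum>m\<le>k. ?\<sigma> * Sx (int (Suc m)) * ?g (Suc m))"
    unfolding sum.distrib [symmetric]
    by (intro sum.cong) (simp_all add: ecoef_Suc_Suc algebra_simps)
  also have "ecoef a s (Suc k) 0 = ?\<sigma> * ?g 0"
    by (simp add: ecoef_def)
  also have "Sx 0 * (?\<sigma> * ?g 0) + ((\<Sum>m\<le>k. ?d * Sx (int (Suc m)) * ?g m) + (\<Sum>m\<le>k. ?\<sigma> * Sx (int (Suc m)) * ?g (Suc m)))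
      = (\<Sum>m\<le>k. ?d * Sx (int (Suc m)) * ?g m) + (\<Sum>m\<le>Suc k. ?\<sigma> * Sx (int m) * ?g m)"
    by (subst sum.atMost_Suc_shift) (simp add: algebra_simps)
  also have "(\<Sum>m\<le>Suc k. ?\<sigma> * Sx (int m) * ?g m) = (\<Sum>m\<le>k. ?\<sigma> * Sx (int m) * ?g m)"
    by (simp add: ecoef_eq_0)
  finally show ?thesis by (simp only: sum.distrib distrib_right)
qed

text \<open>Summed against the \<open>a j\<close>, the two terms of \<phi> become -\<delta>
  S_(m+1)(-x) - \<sigma> S_m(-x). The sign cancels that of \<open>phi_star 0\<close>, and the
  recursion for \<open>evec\<close> applies.\<close>

lemma operator_evec:
  "(\<Sum>j=1..s. scal (a j) (phi (- int j) (phi_star 0 (emb 0 (mfps_const c * evec a s k)))))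
    = emb 0 (of_nat (Suc k) * mfps_const c * evec a s (Suc k))"
proof -
  let ?d = "udel a s 0" and ?\<sigma> = "usig a s"
  define f where "f m = - (of_nat (Suc k) * mfps_const c) * ecoef a s k m" for m
  have uf: "ufun (f m)" for m
    unfolding f_def by (intro ufun_mult ufun_minus ufun_of_nat ufun_const ufun_ecoef)
  have p: "phi (- int j) (emb 1 (\<Sum>m\<le>k. Sx (int (Suc m)) * f m))
      = emb 0 (\<Sum>m\<le>k. (Su (int j - 1) * Sx (int (Suc m)) - Su (int j) * Sx (int m)) * f m)" for j
    by (subst phi_emb [where \<mu> = "\<lambda>m. int (Suc m)"]) (simp_all add: uf)
  have "(\<Sum>j=1..s. scal (a j) (phi (- int j) (phi_star 0 (emb 0 (mfps_const c * evec a s k)))))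
      = emb 0 (\<Sum>j=1..s. mfps_const (a j) * (\<Sum>m\<le>k. (Su (int j - 1) * Sx (int (Suc m)) - Su (int j) * Sx (int m)) * f m))"
    unfolding phi_star_evec f_def [symmetric] p scal_emb emb_sum [of 0 _ "{1..s}"] ..
  also have "(\<Sum>j=1..s. mfps_const (a j) * (\<Sum>m\<le>k. (Su (int j - 1) * Sx (int (Suc m)) - Su (int j) * Sx (int m)) * f m))
      = (\<Sum>m\<le>k. \<Sum>j=1..s. (mfps_const (a j) * Su (int j - 1)) * (Sx (int (Suc m)) * f m)
          - (mfps_const (a j) * Su (int j)) * (Sx (int m) * f m))"
    unfolding sum_distrib_left by (subst sum.swap) (simp only: left_diff_distrib right_diff_distrib mult.assoc)
  also have "\<dots> = (\<Sum>m\<le>k. - (?d * Sx (int (Suc m)) + ?\<sigma> * Sx (int m)) * f m)"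
    unfolding sum_subtractf sum_distrib_right [symmetric] udel_def usig_def
    by (simp del: schurz_of_nat add: left_diff_distrib distrib_right mult.assoc sum_subtractf)
  also have "\<dots> = of_nat (Suc k) * mfps_const c * evec a s (Suc k)"
    unfolding evec_Suc sum_distrib_left f_def
  proof (rule sum.cong)
    fix m
    have "- A * (- B * C) = B * (A * C)" for A B C :: xyser by (simp add: mult.left_commute)
    then show "- (?d * Sx (int (Suc m)) + ?\<sigma> * Sx (int m)) * (- (of_nat (Suc k) * mfps_const c) * ecoef a s k m)
      = of_nat (Suc k) * mfps_const c * ((?d * Sx (int (Suc m)) + ?\<sigma> * Sx (int m)) * ecoef a s k m)" .
  qed simp
  finally show ?thesis .
qed

lemma operator_power_vac:
  "((\<lambda>v. \<Sum>j=1..s. scal (a j) (phi (- int j) (phi_star 0 v))) ^^ k) vac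
    = emb 0 (mfps_const (fact k) * evec a s k)"
proof (induction k)
  case 0
  show ?case
    by (simp add: vac_def fock_embed_def emb_def evec_def ecoef_def mfps_const_simps)
next
  case (Suc k)
  have "of_nat (Suc k) * mfps_const (fact k) = (mfps_const (fact (Suc k)) :: xyser)"
    by (simp only: fact_Suc mfps_const_simps(4) mfps_const_of_nat)
  then show ?case by (simp only: funpow.simps o_apply Suc operator_evec)
qed

lemma op_exp_vac:
  "op_exp (\<lambda>v. \<Sum>j=1..s. scal (a j) (phi (- int j) (phi_star 0 v))) vac
    = (\<Sum>\<^sub>\<infinity>k\<in>UNIV. emb 0 (evec a s k))"
proof -
  have "mfps_const (1 / fact k) * (mfps_const (fact k) * f) = f" for k and f :: xyser
    by (rule mfps_eqI) simp
  then show ?thesis by (simp only: op_exp_def operator_power_vac scal_emb)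
qed

subsection \<open>Summation by weight\<close>

primrec var_weight :: "var \<Rightarrow> nat" where
  "var_weight (X i) = Suc i"
| "var_weight (Y i) = Suc i"

definition weight :: "var multiset \<Rightarrow> nat" where
  "weight m = (\<Sum>v\<in>#m. var_weight v)"

lemma weight_simps [simp]:
  "weight {#} = 0" "weight {#v#} = var_weight v" "weight (m + n) = weight m + weight n"
  by (simp_all add: weight_def)

lemma weight_split: "b \<subseteq># m \<Longrightarrow> weight m = weight b + weight (m - b)"
  by (metis subset_mset.add_diff_inverse weight_simps(3))

definition weight_ge :: "nat \<Rightarrow> xyser \<Rightarrow> bool" where
  "weight_ge n f \<longleftrightarrow> (\<forall>m. weight m < n \<longrightarrow> mfps_coeff f m = 0)"

lemma weight_geD: "weight_ge n f \<Longrightarrow> weight m < n \<Longrightarrow> mfps_coeff f m = 0"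
  by (simp add: weight_ge_def)

lemma weight_ge_simps [simp]:
  "weight_ge 0 f" "weight_ge n 0"
  "weight_ge n f \<Longrightarrow> weight_ge n g \<Longrightarrow> weight_ge n (f + g)"
  "weight_ge n f \<Longrightarrow> weight_ge n g \<Longrightarrow> weight_ge n (f - g)"
  "weight_ge n (- f) \<longleftrightarrow> weight_ge n f"
  by (auto simp: weight_ge_def)

lemma weight_ge_mono: "weight_ge n f \<Longrightarrow> k \<le> n \<Longrightarrow> weight_ge k f"
  by (auto simp: weight_ge_def)

lemma weight_ge_sum: "(\<And>i. i \<in> A \<Longrightarrow> weight_ge n (f i)) \<Longrightarrow> weight_ge n (sum f A)"
  by (simp add: weight_ge_def mfps_coeff_sum sum.neutral)

lemma weight_ge_mult:
  assumes "weight_ge k f" "weight_ge n g"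
  shows "weight_ge (k + n) (f * g)"
  unfolding weight_ge_def mfps_coeff_mult
proof (intro allI impI sum.neutral ballI)
  fix m b assume "weight m < k + n" "b \<in> {b. b \<subseteq># m}"
  then have "weight b < k \<or> weight (m - b) < n" using weight_split [of b m] by auto
  then show "mfps_coeff f b * mfps_coeff g (m - b) = 0"
    using assms by (auto simp: weight_ge_def)
qed

lemma weight_ge_mult_left: "weight_ge n g \<Longrightarrow> weight_ge n (f * g)"
  using weight_ge_mult [of 0 f n g] by simp

lemma weight_ge_power: "weight_ge k f \<Longrightarrow> weight_ge (n * k) (f ^ n)"
  by (induction n) (simp_all add: weight_ge_mult)

lemma weight_ge_var: "weight_ge (var_weight v) (mfps_var v)"
  by (auto simp: weight_ge_def mfps_var_def)

text \<open>By the recursion: the summand with \<open>t l\<close> has weight at least l + (n -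
  l).\<close>

lemma weight_ge_schur:
  assumes "\<And>n. n > 0 \<Longrightarrow> weight_ge n (t n)"
  shows "weight_ge n (schur n t)"
proof (induction n rule: less_induct)
  case (less n)
  show ?case
  proof (cases "n = 0")
    case False
    have "weight_ge n (of_nat n * schur n t)"
      unfolding schur_rec
    proof (rule weight_ge_sum)
      fix l assume l: "l \<in> {1..n}"
      then have "weight_ge (l + (n - l)) ((of_nat l * t l) * schur (n - l) t)"
        by (intro weight_ge_mult weight_ge_mult_left assms less) auto
      with l show "weight_ge n (of_nat l * t l * schur (n - l) t)" by simp
    qed
    then show ?thesis
      using False by (simp add: weight_ge_def flip: mfps_const_of_nat)
  qed simp
qed

lemma weight_ge_xv: "n > 0 \<Longrightarrow> weight_ge n (xv n)" and weight_ge_yv: "n > 0 \<Longrightarrow> weight_ge n (yv n)"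
  using weight_ge_var [of "X (n - 1)"] weight_ge_var [of "Y (n - 1)"]
  by (simp_all add: xv_def yv_def)

section \<open>Summable families encoded as series in an auxiliary variable\<close>

definition graded :: "xyser fps \<Rightarrow> bool" where
  "graded F \<longleftrightarrow> (\<forall>k. weight_ge k (F $ k))"

text \<open>Evaluation at \<open>t = 1\<close> of a series in \<open>t\<close> whose coefficient of \<open>t\<^sup>k\<close> has weight at least \<open>k\<close>.\<close>

definition fsum :: "xyser fps \<Rightarrow> xyser" where
  "fsum F = Abs_mfps (\<lambda>m. \<Sum>k\<le>weight m. mfps_coeff (F $ k) m)"

lemma fsum_coeff:
  assumes "graded F" "weight m \<le> N"
  shows "mfps_coeff (fsum F) m = mfps_coeff (\<Sum>k\<le>N. F $ k) m"
proof -
  have "(\<Sum>k\<le>weight m. mfps_coeff (F $ k) m) = (\<Sum>k\<le>N. mfps_coeff (F $ k) m)"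
    using assms by (intro sum.mono_neutral_left) (auto simp: graded_def weight_ge_def)
  then show ?thesis by (simp add: fsum_def mfps_coeff_sum)
qed

lemma graded_mult:
  assumes "graded F" "graded G" shows "graded (F * G)"
  unfolding graded_def fps_mult_nth
proof (intro allI weight_ge_sum)
  fix k i :: nat assume "i \<in> {0..k}"
  then show "weight_ge k (F $ i * G $ (k - i))"
    using assms weight_ge_mult [of i "F $ i" "k - i" "G $ (k - i)"] by (simp add: graded_def)
qed

lemma graded_simps [simp]: "graded (fps_const c)" "graded 1" "graded (- F) \<longleftrightarrow> graded F"
  by (auto simp: graded_def fps_one_nth)

lemma graded_power: "graded F \<Longrightarrow> graded (F ^ n)"
  by (induction n) (auto simp: graded_mult)

text \<open>At a monomial of weight N both factors may be cut at N. In the square of index pairs,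
  those with i + j > N contribute products of too large weight, and the remaining triangle is the
  Cauchy product.\<close>

lemma fsum_mult:
  assumes F: "graded F" and G: "graded G"
  shows "fsum (F * G) = fsum F * fsum G"
proof (rule mfps_eqI)
  fix m
  define N where "N = weight m"
  have "mfps_coeff (fsum F * fsum G) m = mfps_coeff ((\<Sum>i\<le>N. F $ i) * (\<Sum>j\<le>N. G $ j)) m"
    unfolding mfps_coeff_mult
  proof (rule sum.cong)
    fix b assume "b \<in> {b. b \<subseteq># m}"
    then have "weight b \<le> N" "weight (m - b) \<le> N" using weight_split [of b m] by (auto simp: N_def)
    then show "mfps_coeff (fsum F) b * mfps_coeff (fsum G) (m - b)
        = mfps_coeff (\<Sum>i\<le>N. F $ i) b * mfps_coeff (\<Sum>j\<le>N. G $ j) (m - b)"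
      using F G by (simp add: fsum_coeff)
  qed simp
  also have "(\<Sum>i\<le>N. F $ i) * (\<Sum>j\<le>N. G $ j) = (\<Sum>(i, j)\<in>{..N} \<times> {..N}. F $ i * G $ j)"
    by (simp add: sum_product sum.cartesian_product)
  also have "mfps_coeff \<dots> m = (\<Sum>(i, j)\<in>{..N} \<times> {..N}. mfps_coeff (F $ i * G $ j) m)"
    by (simp add: mfps_coeff_sum case_prod_unfold)
  also have "\<dots> = (\<Sum>(i, j)\<in>{(i, j). i + j \<le> N}. mfps_coeff (F $ i * G $ j) m)"
  proof (rule sum.mono_neutral_right)
    show "\<forall>p\<in>{..N} \<times> {..N} - {(i, j). i + j \<le> N}. (case p of (i, j) \<Rightarrow> mfps_coeff (F $ i * G $ j) m) = 0"
    proof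
      fix p assume p: "p \<in> {..N} \<times> {..N} - {(i, j). i + j \<le> N}"
      obtain i j where ij: "p = (i, j)" by force
      have "weight_ge (i + j) (F $ i * G $ j)"
        using F G by (intro weight_ge_mult) (auto simp: graded_def)
      then have "mfps_coeff (F $ i * G $ j) m = 0"
        by (rule weight_geD) (use p in \<open>auto simp: ij N_def\<close>)
      then show "(case p of (i, j) \<Rightarrow> mfps_coeff (F $ i * G $ j) m) = 0"
        by (simp add: ij)
    qed
  qed auto
  also have "\<dots> = (\<Sum>k\<le>N. \<Sum>i\<le>k. mfps_coeff (F $ i * G $ (k - i)) m)"
    by (rule sum.triangle_reindex_eq)
  also have "\<dots> = mfps_coeff (fsum (F * G)) m"
    by (simp add: fsum_def N_def fps_mult_nth mfps_coeff_sum atLeast0AtMost)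
  finally show "mfps_coeff (fsum (F * G)) m = mfps_coeff (fsum F * fsum G) m" by simp
qed

lemma fsum_const_X_power: "weight_ge n c \<Longrightarrow> fsum (fps_const c * fps_X ^ n) = c"
proof (rule mfps_eqI)
  fix m assume c: "weight_ge n c"
  then have "graded (fps_const c * fps_X ^ n)"
    by (auto simp: graded_def fps_X_power_iff)
  then have "mfps_coeff (fsum (fps_const c * fps_X ^ n)) m
      = mfps_coeff (\<Sum>k\<le>weight m + n. (fps_const c * fps_X ^ n) $ k) m"
    by (rule fsum_coeff) simp
  also have "(\<Sum>k\<le>weight m + n. (fps_const c * fps_X ^ n) $ k) = (\<Sum>k\<le>weight m + n. if k = n then c else 0)"
    by (intro sum.cong) (auto simp: fps_X_power_iff)
  finally show "mfps_coeff (fsum (fps_const c * fps_X ^ n)) m = mfps_coeff c m" by simp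
qed

lemma fsum_const [simp]: "fsum (fps_const c) = c"
  using fsum_const_X_power [of 0 c] by simp

lemma fsum_1 [simp]: "fsum 1 = 1"
  using fsum_const [of 1] by (simp del: fsum_const)

lemma fsum_add: "fsum (F + G) = fsum F + fsum G"
  and fsum_minus: "fsum (- F) = - fsum F"
  by (rule mfps_eqI; simp add: fsum_def sum.distrib sum_negf)+

lemma fsum_power: "graded F \<Longrightarrow> fsum (F ^ n) = fsum F ^ n"
  by (induction n) (auto simp: fsum_mult graded_power)

lemma fsum_const_mult: "graded F \<Longrightarrow> fsum (fps_const c * F) = c * fsum F"
  by (simp add: fsum_mult)

text \<open>A basic neighbourhood in the product topology restricts finitely many coefficients, and
  each coefficient is final once its finite set \<open>K m\<close> has been summed.\<close>

lemma mfps_has_sumI: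
  fixes f :: "'i \<Rightarrow> ('v, complex) mfps"
  assumes fin: "\<And>m. finite (K m)" and sub: "\<And>m. K m \<subseteq> A"
    and zero: "\<And>m k. k \<in> A - K m \<Longrightarrow> mfps_coeff (f k) m = 0"
    and S: "\<And>m. mfps_coeff S m = (\<Sum>k\<in>K m. mfps_coeff (f k) m)"
  shows "(f has_sum S) A"
  unfolding has_sum_def
proof (rule topological_tendstoI)
  fix U assume U: "open U" "S \<in> U"
  then have "openin (product_topology (\<lambda>_. euclidean) UNIV) (Abs_mfps -` U)"
    by (simp add: open_mfps_def euclidean_product_topology)
  moreover have "mfps_coeff S \<in> Abs_mfps -` U" using U by simp
  ultimately obtain V where V: "mfps_coeff S \<in> Pi\<^sub>E UNIV V"
      "finite {m. V m \<noteq> topspace euclidean}" "Pi\<^sub>E UNIV V \<subseteq> Abs_mfps -` U"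
    using product_topology_open_contains_basis [of "\<lambda>_. euclidean" UNIV "Abs_mfps -` U" "mfps_coeff S"]
    by auto
  define J where "J = {m. V m \<noteq> topspace euclidean}"
  show "eventually (\<lambda>F. sum f F \<in> U) (finite_subsets_at_top A)"
    unfolding eventually_finite_subsets_at_top
  proof (intro exI conjI allI impI)
    show "finite (\<Union>m\<in>J. K m)" using V(2) fin by (auto simp: J_def)
    show "(\<Union>m\<in>J. K m) \<subseteq> A" using sub by auto
    fix F assume F: "finite F \<and> (\<Union>m\<in>J. K m) \<subseteq> F \<and> F \<subseteq> A"
    have "mfps_coeff (sum f F) \<in> Pi\<^sub>E UNIV V"
    proof (rule PiE_I)
      fix m
      show "mfps_coeff (sum f F) m \<in> V m"
      proof (cases "m \<in> J")
        case True
        then have "mfps_coeff (sum f F) m = mfps_coeff S m"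
          unfolding mfps_coeff_sum S using F zero by (intro sum.mono_neutral_right) auto
        then show ?thesis using V(1) by auto
      qed (simp add: J_def)
    qed simp
    then have "mfps_coeff (sum f F) \<in> Abs_mfps -` U" using V(3) by blast
    then show "sum f F \<in> U" by simp
  qed
qed

lemma has_sum_fsum:
  assumes "graded F"
  shows "((\<lambda>k. F $ k) has_sum fsum F) UNIV"
  by (rule mfps_has_sumI [where K = "\<lambda>m. {..weight m}"])
    (use assms in \<open>auto simp: fsum_def graded_def weight_ge_def\<close>)

text \<open>The exchange of summation: at a given monomial only m \<le> k \<le> weight matters, so
  both orders are finite sums over the same triangle.\<close>

lemma has_sum_fsum_lower_triangular:
  assumes Q: "\<And>m. graded (Q m)" and tri: "\<And>m k. k < m \<Longrightarrow> Q m $ k = 0"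
  shows "((\<lambda>m. fsum (Q m)) has_sum fsum (Abs_fps (\<lambda>k. \<Sum>m\<le>k. Q m $ k))) UNIV"
proof (rule mfps_has_sumI [where K = "\<lambda>\<mu>. {..weight \<mu>}"])
  fix \<mu> m assume "m \<in> UNIV - {..weight \<mu>}"
  then show "mfps_coeff (fsum (Q m)) \<mu> = 0"
    by (auto simp: fsum_def tri intro!: sum.neutral)
next
  fix \<mu>
  have "mfps_coeff (fsum (Abs_fps (\<lambda>k. \<Sum>m\<le>k. Q m $ k))) \<mu>
      = (\<Sum>k\<le>weight \<mu>. \<Sum>m\<le>k. mfps_coeff (Q m $ k) \<mu>)"
    by (simp add: fsum_def mfps_coeff_sum)
  also have "\<dots> = (\<Sum>k\<le>weight \<mu>. \<Sum>m\<le>weight \<mu>. mfps_coeff (Q m $ k) \<mu>)"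
    by (intro sum.cong refl sum.mono_neutral_left) (auto simp: tri)
  also have "\<dots> = (\<Sum>m\<le>weight \<mu>. mfps_coeff (fsum (Q m)) \<mu>)"
    unfolding fsum_def mfps_coeff_Abs by (rule sum.swap)
  finally show "mfps_coeff (fsum (Abs_fps (\<lambda>k. \<Sum>m\<le>k. Q m $ k))) \<mu>
      = (\<Sum>m\<le>weight \<mu>. mfps_coeff (fsum (Q m)) \<mu>)" .
qed auto

lemma has_sum_emb:
  assumes "(f has_sum S) A" shows "((\<lambda>k. emb q (f k)) has_sum emb q S) A"
proof -
  have "continuous_on UNIV (emb q)"
  proof (rule continuous_on_coordinatewise_then_product)
    fix r
    show "continuous_on UNIV (\<lambda>f. emb q f r)"
      by (cases "r = q") (simp_all add: emb_def)
  qed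
  then have "((\<lambda>F. emb q (sum f F)) \<longlongrightarrow> emb q S) (finite_subsets_at_top A)"
    using assms unfolding has_sum_def by (rule continuous_on_tendsto_compose) auto
  moreover have "(\<lambda>F. emb q (sum f F)) = sum (\<lambda>k. emb q (f k))"
    by (simp add: fun_eq_iff emb_sum)
  ultimately show ?thesis by (simp only: has_sum_def)
qed

subsection \<open>The closed form\<close>

lemma mfps_inverse_eqI:
  fixes D E :: "('v, complex) mfps"
  assumes DE: "D * E = 1"
  shows "inverse D = E"
proof -
  have "(THE g. D * g = 1) = E"
  proof (rule the_equality)
    show "D * E = 1" by (rule DE)
  next
    fix g assume "D * g = 1"
    then have "E = E * (D * g)" by simp
    also have "\<dots> = (D * E) * g" by (simp only: ac_simps)
    finally show "g = E" using DE by simp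
  qed
  then show ?thesis by (simp only: inverse_mfps_def if_P [OF exI [of "\<lambda>g. D * g = 1", OF DE]])
qed

text \<open>The substitution of h w for w in the generating series, carried out on the
  recursion.\<close>

lemma schur_scale: "schur n (\<lambda>n. t n * h ^ n) = schur n t * h ^ n"
proof (rule schur_unique [symmetric, where g = "\<lambda>n. schur n t * h ^ n"])
  fix n :: nat
  have "of_nat n * (schur n t * h ^ n) = (\<Sum>l=1..n. of_nat l * t l * schur (n - l) t) * h ^ n"
    by (simp only: schur_rec mult.assoc [symmetric])
  also have "\<dots> = (\<Sum>l=1..n. of_nat l * (t l * h ^ l) * (schur (n - l) t * h ^ (n - l)))"
    unfolding sum_distrib_right
  proof (rule sum.cong)
    fix l assume "l \<in> {1..n}"
    then have "h ^ n = h ^ l * h ^ (n - l)" by (simp add: power_add [symmetric])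
    then show "of_nat l * t l * schur (n - l) t * h ^ n = of_nat l * (t l * h ^ l) * (schur (n - l) t * h ^ (n - l))"
      by (simp add: ac_simps)
  qed simp
  finally show "of_nat n * (schur n t * h ^ n)
      = (\<Sum>l=1..n. of_nat l * (t l * h ^ l) * (schur (n - l) t * h ^ (n - l)))" .
qed simp

lemma graded_fps_arg: "(\<And>n. n > 0 \<Longrightarrow> weight_ge n (t n)) \<Longrightarrow> graded (fps_arg t)"
  by (auto simp: graded_def fps_arg_def)

text \<open>Evaluation at 1 commutes with exp: the double sum over the power k and the degree n is
  triangular because T^k starts in degree k.\<close>

lemma mfps_exp_fsum:
  assumes t: "\<And>n. n > 0 \<Longrightarrow> weight_ge n (t n)"
  shows "mfps_exp (fsum (fps_arg t)) = fsum (Abs_fps (\<lambda>n. schur n t))"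
proof -
  define Q where "Q k = fps_const (mfps_const (1 / fact k)) * fps_arg t ^ k" for k
  have g: "graded (fps_arg t)" using t by (rule graded_fps_arg)
  have "graded (Q k)" for k unfolding Q_def by (intro graded_mult graded_power g) simp
  moreover have "Q k $ n = 0" if "n < k" for k n
    using that by (simp add: Q_def fps_power_nth_0 fps_arg_def)
  ultimately have "((\<lambda>k. fsum (Q k)) has_sum fsum (Abs_fps (\<lambda>n. \<Sum>k\<le>n. Q k $ n))) UNIV"
    by (rule has_sum_fsum_lower_triangular)
  moreover have "fsum (Q k) = mfps_const (1 / fact k) * fsum (fps_arg t) ^ k" for k
    by (simp add: Q_def fsum_const_mult graded_power g fsum_power)
  moreover have "(\<Sum>k\<le>n. Q k $ n) = schur n t" for n
    by (simp add: Q_def schur_sum [OF order_refl])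
  ultimately show ?thesis by (simp add: mfps_exp_def infsumI)
qed

lemma infsum_fsum_fps_arg:
  assumes t: "\<And>n. n > 0 \<Longrightarrow> weight_ge n (t n)"
  shows "(\<Sum>\<^sub>\<infinity>n\<in>{1..}. t n) = fsum (fps_arg t)"
proof -
  have "(\<Sum>\<^sub>\<infinity>n\<in>{1..}. t n) = (\<Sum>\<^sub>\<infinity>n\<in>UNIV. fps_arg t $ n)"
    by (intro infsum_cong_neutral) (auto simp: fps_arg_def)
  then show ?thesis
    using has_sum_fsum [OF graded_fps_arg [OF t]] by (simp add: infsumI)
qed

text \<open>The expansion of (1 - \<sigma> X)^(-m-1) in X.\<close>

definition geom_power :: "xyser \<Rightarrow> nat \<Rightarrow> xyser fps" where
  "geom_power \<sigma> m = Abs_fps (\<lambda>l. of_nat ((m + l) choose m) * \<sigma> ^ l)"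

context
  fixes \<sigma> :: xyser
  assumes \<sigma>: "weight_ge 1 \<sigma>"
begin

lemma graded_geom_power: "graded (geom_power \<sigma> m)"
  using weight_ge_power [OF \<sigma>] by (auto simp: graded_def geom_power_def intro!: weight_ge_mult_left)

text \<open>Pascal's rule for the coefficients; at m = 0 the geometric series telescopes to
  1.\<close>

lemma mult_geom_power:
  "(1 - fps_const \<sigma> * fps_X) * geom_power \<sigma> m = (if m = 0 then 1 else geom_power \<sigma> (m - 1))"
proof (rule fps_ext)
  fix n
  have "((1 - fps_const \<sigma> * fps_X) * geom_power \<sigma> m) $ n
      = geom_power \<sigma> m $ n - (if n = 0 then 0 else \<sigma> * geom_power \<sigma> m $ (n - 1))"
    by (simp add: left_diff_distrib mult.assoc)
  also have "\<dots> = (if m = 0 then 1 else geom_power \<sigma> (m - 1)) $ n"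
    by (cases n; cases m) (simp_all add: geom_power_def fps_one_nth binomial_eq_0 algebra_simps)
  finally show "((1 - fps_const \<sigma> * fps_X) * geom_power \<sigma> m) $ n
      = (if m = 0 then 1 else geom_power \<sigma> (m - 1)) $ n" .
qed

lemma one_minus_mult_fsum_geom_power:
  "(1 - \<sigma>) * fsum (geom_power \<sigma> m) = (if m = 0 then 1 else fsum (geom_power \<sigma> (m - 1)))"
proof -
  let ?L = "1 - fps_const \<sigma> * fps_X"
  have gX: "graded (fps_const \<sigma> * fps_X)"
    using \<sigma> by (auto simp: graded_def fps_X_def)
  have "graded ?L"
    using gX by (auto simp: graded_def fps_one_nth)
  moreover have "fsum ?L = 1 - \<sigma>"
    using fsum_const_X_power [OF \<sigma>] fsum_add [of 1 "- (fps_const \<sigma> * fps_X)"]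
    by (simp add: fsum_minus)
  ultimately have "(1 - \<sigma>) * fsum (geom_power \<sigma> m) = fsum (?L * geom_power \<sigma> m)"
    by (simp add: fsum_mult graded_geom_power)
  then show ?thesis by (simp add: mult_geom_power)
qed

text \<open>The case m = 0 exhibits the inverse of 1 - \<sigma>; every further step of m divides by
  1 - \<sigma> once more.\<close>

lemma fsum_geom_power: "fsum (geom_power \<sigma> m) = inverse (1 - \<sigma>) ^ Suc m"
proof -
  have I: "inverse (1 - \<sigma>) = fsum (geom_power \<sigma> 0)"
    using one_minus_mult_fsum_geom_power [of 0] by (intro mfps_inverse_eqI) simp
  then have inv: "inverse (1 - \<sigma>) * (1 - \<sigma>) = 1"
    using one_minus_mult_fsum_geom_power [of 0] by (simp add: mult.commute)
  show ?thesis
  proof (induction m)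
    case (Suc m)
    have "fsum (geom_power \<sigma> (Suc m)) = inverse (1 - \<sigma>) * ((1 - \<sigma>) * fsum (geom_power \<sigma> (Suc m)))"
      by (simp only: mult.assoc [symmetric] inv mult_1)
    also have "\<dots> = inverse (1 - \<sigma>) * fsum (geom_power \<sigma> m)"
      by (simp add: one_minus_mult_fsum_geom_power)
    finally show ?case by (simp add: Suc)
  qed (simp add: I)
qed

text \<open>Expanding \<open>(1 - \<sigma>)\<^sup>-\<^sup>m\<^sup>-\<^sup>1\<close> and collecting the terms of equal degree in \<open>\<sigma>\<close> and \<open>\<delta>\<close>.\<close>

lemma closed_form_expansion:
  assumes w: "\<And>m. weight_ge m (c m)"
  defines "Di \<equiv> inverse (1 - \<sigma>)"
  shows "Di * fsum (Abs_fps (\<lambda>m. c m * (\<delta> * Di) ^ m))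
    = fsum (Abs_fps (\<lambda>k. \<Sum>m\<le>k. c m * (of_nat (k choose m) * \<delta> ^ m * \<sigma> ^ (k - m))))"
proof -
  define b where "b m = c m * \<delta> ^ m" for m
  \<comment> \<open>\<open>fps_X\<close> marks the total degree k in \<sigma> and \<delta>, so
    \<open>Q m\<close> collects the terms with \<delta>^m \<sigma>^(k-m).\<close>
  define Q where "Q m = (fps_const (b m) * fps_X ^ m) * geom_power \<sigma> m" for m
  \<comment> \<open>The weight comes from \<open>c m\<close> alone, since \<delta> may have a
    constant term.\<close>
  have b: "weight_ge m (b m)" for m
    using weight_ge_mult_left [OF w, of m "\<delta> ^ m"] by (simp add: b_def mult.commute)
  have gb: "graded (fps_const (b m) * fps_X ^ m)" for m
    using b by (auto simp: graded_def fps_X_power_iff)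
  have Q: "Q m $ k = (if k < m then 0 else c m * (of_nat (k choose m) * \<delta> ^ m * \<sigma> ^ (k - m)))" for m k
    by (simp add: Q_def mult.assoc fps_X_power_mult_nth b_def geom_power_def mult.left_commute)
  have "graded (Q m)" for m
    unfolding Q_def by (intro graded_mult gb graded_geom_power)
  then have "((\<lambda>m. fsum (Q m)) has_sum fsum (Abs_fps (\<lambda>k. \<Sum>m\<le>k. Q m $ k))) UNIV"
    by (rule has_sum_fsum_lower_triangular) (simp add: Q)
  moreover have "(\<Sum>m\<le>k. Q m $ k) = (\<Sum>m\<le>k. c m * (of_nat (k choose m) * \<delta> ^ m * \<sigma> ^ (k - m)))" for k
    by (intro sum.cong) (auto simp: Q)
  moreover have "fsum (Q m) = (fps_const Di * Abs_fps (\<lambda>m. c m * (\<delta> * Di) ^ m)) $ m" for m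
    unfolding Q_def fsum_mult [OF gb graded_geom_power] fsum_const_X_power [OF b] fsum_geom_power
    by (simp add: b_def Di_def power_mult_distrib ac_simps)
  moreover have gc: "graded (Abs_fps (\<lambda>m. c m * (\<delta> * Di) ^ m))"
    unfolding graded_def fps_nth_Abs_fps mult.commute [of "c _"] by (intro allI weight_ge_mult_left w)
  ultimately have collected: "((\<lambda>m. (fps_const Di * Abs_fps (\<lambda>m. c m * (\<delta> * Di) ^ m)) $ m) has_sum
      fsum (Abs_fps (\<lambda>k. \<Sum>m\<le>k. c m * (of_nat (k choose m) * \<delta> ^ m * \<sigma> ^ (k - m))))) UNIV"
    by (simp only:)
  \<comment> \<open>The same family over m, now with the common factor \<open>Di\<close> taken out;
    uniqueness of the sum then identifies both results.\<close>
  have factored: "((\<lambda>m. (fps_const Di * Abs_fps (\<lambda>m. c m * (\<delta> * Di) ^ m)) $ m) has_sum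
      Di * fsum (Abs_fps (\<lambda>m. c m * (\<delta> * Di) ^ m))) UNIV"
    unfolding fsum_const_mult [OF gc, symmetric]
    by (rule has_sum_fsum) (intro graded_mult gc graded_simps)
  show ?thesis
    by (rule trans [OF infsumI [OF factored, symmetric] infsumI [OF collected]])
qed

end

section \<open>Weights of the concrete series, and the conclusion\<close>

lemma weight_ge_usig: "weight_ge 1 (usig a s)"
  unfolding usig_def
proof (rule weight_ge_sum)
  fix j assume "j \<in> {1..s}"
  moreover have "weight_ge j (schur j (\<lambda>n. - xv n - yv n))"
    by (rule weight_ge_schur) (simp add: weight_ge_xv weight_ge_yv)
  ultimately show "weight_ge 1 (mfps_const (a j) * Su (int j))"
    by (intro weight_ge_mult_left) (auto elim: weight_ge_mono)
qed

text \<open>S_m(-x) supplies weight m and the power of \<sigma> supplies k - m, so the sum of the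
  \<open>evec a s k\<close> over k converges.\<close>

lemma weight_ge_evec: "weight_ge k (evec a s k)"
  unfolding evec_def
proof (rule weight_ge_sum)
  fix m assume m: "m \<in> {..k}"
  have "weight_ge m (Sx (int m))"
    by (simp, rule weight_ge_schur) (simp add: weight_ge_xv)
  moreover have "weight_ge (k - m) (usig a s ^ (k - m))"
    using weight_ge_power [OF weight_ge_usig, of "k - m"] by simp
  ultimately have "weight_ge (m + (k - m)) (Sx (int m) * ecoef a s k m)"
    unfolding ecoef_def by (intro weight_ge_mult weight_ge_mult_left)
  with m show "weight_ge k (Sx (int m) * ecoef a s k m)" by simp
qed

theorem theorem3p1:
  fixes s :: nat and a :: "nat \<Rightarrow> complex"
  assumes "s \<ge> 1"
  shows "op_exp (\<lambda>v. \<Sum>j=1..s. scal (a j) (phi (- int j) (phi_star 0 v))) vac =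
    (let S = (\<lambda>k. schur k (\<lambda>n. - xv n - yv n));
         D = 1 - (\<Sum>j=1..s. mfps_const (a j) * S j);
         N = - (\<Sum>j=1..s. mfps_const (a j) * S (j - 1))
     in fock_embed (1 / D * mfps_exp (- (\<Sum>\<^sub>\<infinity>n\<in>{1..}. xv n * (N / D) ^ n))))"
proof -
  define \<sigma> where "\<sigma> = usig a s"
  define \<delta> where "\<delta> = udel a s 0"
  define h where "h = \<delta> * inverse (1 - \<sigma>)"
  have \<sigma>: "(\<Sum>j=1..s. mfps_const (a j) * schur j (\<lambda>n. - xv n - yv n)) = \<sigma>"
    by (simp add: \<sigma>_def usig_def)
  have \<delta>: "- (\<Sum>j=1..s. mfps_const (a j) * schur (j - 1) (\<lambda>n. - xv n - yv n)) = \<delta>"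
    unfolding \<delta>_def udel_def
    by (intro arg_cong [where f = uminus] sum.cong refl) (simp add: schurz_def nat_diff_distrib)
  \<comment> \<open>The factor x_n alone makes the sum over n converge, as h may have a constant
    term.\<close>
  have wx: "weight_ge n (xv n * h ^ n)" "weight_ge n (- xv n * h ^ n)" if "n > 0" for n
    using weight_ge_mult_left [OF weight_ge_xv [OF that], of "h ^ n"] by (simp_all add: mult.commute)
  have "- (\<Sum>\<^sub>\<infinity>n\<in>{1..}. xv n * h ^ n) = - fsum (fps_arg (\<lambda>n. xv n * h ^ n))"
    by (simp only: infsum_fsum_fps_arg wx)
  also have "\<dots> = fsum (fps_arg (\<lambda>n. - xv n * h ^ n))"
    unfolding fsum_minus [symmetric] by (rule arg_cong [where f = fsum], rule fps_ext) (simp add: fps_arg_def)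
  finally have "mfps_exp (- (\<Sum>\<^sub>\<infinity>n\<in>{1..}. xv n * h ^ n))
      = fsum (Abs_fps (\<lambda>n. schur n (\<lambda>n. - xv n) * h ^ n))"
    using wx(2) by (simp only: mfps_exp_fsum schur_scale)
  moreover have "inverse (1 - \<sigma>) * fsum (Abs_fps (\<lambda>n. schur n (\<lambda>n. - xv n) * h ^ n))
      = fsum (Abs_fps (evec a s))"
  proof -
    have "weight_ge m (schur m (\<lambda>n. - xv n))" for m
      by (rule weight_ge_schur) (simp add: weight_ge_xv)
    moreover have "evec a s = (\<lambda>k. \<Sum>m\<le>k. schur m (\<lambda>n. - xv n) * (of_nat (k choose m) * \<delta> ^ m * \<sigma> ^ (k - m)))"
      by (simp add: fun_eq_iff evec_def ecoef_def \<sigma>_def \<delta>_def)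
    ultimately show ?thesis
      using closed_form_expansion [of \<sigma> "\<lambda>m. schur m (\<lambda>n. - xv n)" \<delta>] weight_ge_usig
      by (simp only: h_def \<sigma>_def)
  qed
  moreover have "op_exp (\<lambda>v. \<Sum>j=1..s. scal (a j) (phi (- int j) (phi_star 0 v))) vac
      = emb 0 (fsum (Abs_fps (evec a s)))"
  proof -
    have "graded (Abs_fps (evec a s))" by (simp add: graded_def weight_ge_evec)
    from has_sum_emb [OF has_sum_fsum [OF this], of 0] show ?thesis
      unfolding op_exp_vac by (intro infsumI) simp
  qed
  moreover have "emb 0 = fock_embed"
    by (simp add: fun_eq_iff emb_def fock_embed_def)
  ultimately show ?thesis
    unfolding Let_def \<sigma> \<delta> divide_mfps_def h_def [symmetric] by simp
qed

end
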